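(* Fix $d\ge 2$ and let $\{g_\ell : \ell\in\mathbb N\}$ be a regular family of monotonic excursion functionals on $S^d$, and let $c>0$ be a constant such that $|\Psi_\ell'(u)|\le \frac{c}{1+|u|}$ for all $u\in\mathbb R$ and all $\ell\in\mathbb{N}$, where $\Psi_\ell(u)=\mathbb E[g_\ell(T_\ell,u)]$. Let $$\sigma_\ell^2=\sup_{u\in\mathbb R}\operatorname{Var}\bigl(g_\ell(T_\ell,u)\bigr),\qquad G_\ell(\varepsilon,u)=\Bigl\{\alpha_\ell\in S^{n_{\ell d}-1} : \bigl|g_\ell(h_{\alpha,\ell},u)-\mathbb E[g_\ell(T_\ell,u)]\bigr|>\varepsilon\Bigr\}.$$ Then for all sequences $(\varepsilon_\ell)$ with values in $(0,1)$ and all $\ell$, $$\sup_{u\in\mathbb R}\mu_\ell\bigl(G_\ell(\varepsilon_\ell,u)\bigr)\le \frac{2(1+c)}{\varepsilon_\ell^2}\left(\frac1{n_{\ell d}}+\sigma_\ell^2\right).$$ In particular, for vanishing sequences $(\varepsilon_\ell)_{\ell\ge1}$ (with values in $(0,1)$) such that $\frac1{n_{\ell d}}+\sigma_\ell^2=o(\varepsilon_\ell^2)$ as $\ell\to\infty$, one has $\sup_{u}\mu_\ell(G_\ell(\varepsilon_\ell,u))\to0$ as $\ell\to\infty$.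
   Context: Let $S^d\subset\mathbb R^{d+1}$ be the unit sphere with normalized (total mass one) Lebesgue measure. For $\ell\ge1$ let $\{Y_{\ell m}: 1\le m\le n_{\ell d}\}$ be a real orthonormal basis (in $L^2$ of the normalized measure) of the eigenspace $\{f:\Delta_{S^d}f=-\ell(\ell+d-1)f\}$ of the Laplace--Beltrami operator, where $n_{\ell d}=\frac{2\ell+d-1}{\ell}\binom{\ell+d-2}{\ell-1}$ is its dimension. For $\alpha_\ell=(\alpha_{\ell1},\dots,\alpha_{\ell n_{\ell d}})$ in the unit sphere $S^{n_{\ell d}-1}\subset\mathbb R^{n_{\ell d}}$ put $h_{\alpha,\ell}=\sum_{m=1}^{n_{\ell d}}\alpha_{\ell m}Y_{\ell m}$; $\mu_\ell$ is the normalized Lebesgue (uniform) probability measure on $S^{n_{\ell d}-1}$. $T_\ell=\sum_{m=1}^{n_{\ell d}}u_{\ell m}Y_{\ell m}$ where $(u_{\ell 1},\dots,u_{\ell n_{\ell d}})$ is a centered Gaussian vector with covariance matrix $n_{\ell d}^{-1}I_{n_{\ell d}}$, so that $T_\ell$ is a zero-mean, unit-variance Gaussian random field on $S^d$. Excursion sets: for $f:S^d\to\mathbb R$ and $u\in\mathbb R$, $A_u(f;S^d)=\{x\in S^d: f(x)\ge u\}$. A functional $g:\mathcal B(S^d)\to\mathbb R$ on Borel sets is monotonic if either $A\subset B\Rightarrow g(A)\le g(B)$ for all Borel $A,B$, or $A\subset B\Rightarrow g(A)\ge g(B)$ for all Borel $A,B$. Notation: $g(f,u):=g(A_u(f;S^d))$;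 in particular $g(f,u)=g(cf,cu)$ for all $c>0$. A family $\{g_\ell:\ell\in\mathbb N\}$ of monotonic excursion functionals is called regular if: (1) for all $u\in\mathbb R$, $\mathbb E[g_\ell(T_\ell,u)]=\Psi_\ell(u)\to\Psi(u)$ as $\ell\to\infty$ for some function $\Psi$, where $\Psi_\ell$ is differentiable and, uniformly over $\ell$, $|\Psi_\ell'(u)|\le\frac{c}{1+|u|}$ for some $c>0$; (2) $\sup_u\operatorname{Var}(g_\ell(T_\ell,u))=o(\ell)$. *)

theory Defs
  imports "HOL-Probability.Probability"
begin

section \<open>Spherical harmonics\<close>

text \<open>The sphere \<open>S^d\<close> is \<^term>\<open>sphere 0 1\<close> in a Euclidean space \<open>'a\<close> with \<open>DIM('a) = d + 1\<close>.
  Functions on it are represented by total functions \<open>'a \<Rightarrow> real\<close> whose values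
  off the sphere are never used.\<close>

text \<open>Normalized Lebesgue measure on the unit sphere: the measure of \<open>A\<close> is the normalized volume
  of the cone \<open>{r x | 0 < r \<le> 1, x \<in> A}\<close>. The origin is removed so that the radial projection
  is a map into the sphere.\<close>

definition sphere_measure :: "'a::euclidean_space measure" where
  "sphere_measure =
     distr (uniform_measure (restrict_space lborel (cball 0 1 - {0})) (cball 0 1 - {0}))
           (restrict_space borel (sphere 0 1)) (\<lambda>x. x /\<^sub>R norm x)"

definition radial_ext :: "('a::euclidean_space \<Rightarrow> real) \<Rightarrow> 'a \<Rightarrow> real" where
  "radial_ext f x = f (x /\<^sub>R norm x)"

text \<open>\<open>C^k\<close> functions; meant for open \<open>U\<close>.\<close>

primrec Ck_on :: "nat \<Rightarrow> 'a::euclidean_space set \<Rightarrow> ('a \<Rightarrow> real) \<Rightarrow> bool" where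
  "Ck_on 0 U F \<longleftrightarrow> continuous_on U F"
| "Ck_on (Suc k) U F \<longleftrightarrow> F differentiable_on U \<and>
     (\<forall>b\<in>Basis. Ck_on k U (\<lambda>x. frechet_derivative F (at x) b))"

definition smooth_on_sphere :: "('a::euclidean_space \<Rightarrow> real) \<Rightarrow> bool" where
  "smooth_on_sphere f \<longleftrightarrow> (\<forall>k. Ck_on k (- {0}) (radial_ext f))"

definition laplacian :: "('a::euclidean_space \<Rightarrow> real) \<Rightarrow> 'a \<Rightarrow> real" where
  "laplacian F x =
     (\<Sum>b\<in>Basis. frechet_derivative (\<lambda>y. frechet_derivative F (at y) b) (at x) b)"

text \<open>The Laplace--Beltrami operator of the unit sphere is the Euclidean Laplacian of the
  extension that is constant along rays.\<close>

definition laplace_beltrami :: "('a::euclidean_space \<Rightarrow> real) \<Rightarrow> 'a \<Rightarrow> real" where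
  "laplace_beltrami f = laplacian (radial_ext f)"

definition eigenspace :: "nat \<Rightarrow> nat \<Rightarrow> ('a::euclidean_space \<Rightarrow> real) set" where
  "eigenspace d l = {f. smooth_on_sphere f \<and>
     (\<forall>x\<in>sphere 0 1. laplace_beltrami f x = - (real l * (real l + real d - 1)) * f x)}"

text \<open>The division is exact; see \<open>real_harm_dim\<close>.\<close>

definition harm_dim :: "nat \<Rightarrow> nat \<Rightarrow> nat" where
  "harm_dim d l = ((2 * l + d - 1) * ((l + d - 2) choose (l - 1))) div l"

lemma real_harm_dim:
  assumes "d \<ge> 2" "l \<ge> 1"
  shows "real (harm_dim d l) =
    (2 * real l + real d - 1) / real l * real ((l + d - 2) choose (l - 1))"
proof -
  obtain k where l: "l = Suc k"
    using assms by (cases l) auto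
  obtain e where d: "d = Suc (Suc e)"
    using assms by (metis add_2_eq_Suc le_Suc_ex)
  have "(k + Suc e choose Suc k) * Suc k = Suc e * (k + Suc e choose k)"
    using binomial_absorb_comp[of "k + Suc e" k] binomial_absorption[of k "k + Suc e"]
    by (simp add: mult.commute)
  then have "Suc k dvd Suc e * (k + Suc e choose k)"
    by (metis dvd_triv_right)
  then have "l dvd (d - 1) * ((l + d - 2) choose (l - 1))"
    by (simp add: l d)
  then have "l dvd 2 * l * ((l + d - 2) choose (l - 1)) + (d - 1) * ((l + d - 2) choose (l - 1))"
    by (intro dvd_add) simp_all
  moreover have "2 * l * ((l + d - 2) choose (l - 1)) + (d - 1) * ((l + d - 2) choose (l - 1))
      = (2 * l + d - 1) * ((l + d - 2) choose (l - 1))"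
    using assms by (simp flip: add_mult_distrib)
  ultimately have "l dvd (2 * l + d - 1) * ((l + d - 2) choose (l - 1))"
    by simp
  then show ?thesis
    using assms by (simp add: harm_dim_def real_of_nat_div of_nat_diff field_simps)
qed

definition harm_sum :: "nat \<Rightarrow> (nat \<Rightarrow> 'a \<Rightarrow> real) \<Rightarrow> (nat \<Rightarrow> real) \<Rightarrow> 'a \<Rightarrow> real" where
  "harm_sum n Y a x = (\<Sum>m=1..n. a m * Y m x)"

definition orthonormal_eigenbasis ::
    "nat \<Rightarrow> nat \<Rightarrow> (nat \<Rightarrow> 'a::euclidean_space \<Rightarrow> real) \<Rightarrow> bool" where
  "orthonormal_eigenbasis d l Y \<longleftrightarrow>
     (\<forall>m\<in>{1..harm_dim d l}. Y m \<in> eigenspace d l) \<and>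
     (\<forall>m\<in>{1..harm_dim d l}. \<forall>k\<in>{1..harm_dim d l}.
        (LINT x|sphere_measure. Y m x * Y k x) = (if m = k then 1 else 0)) \<and>
     (\<forall>f\<in>eigenspace d l. \<exists>a. \<forall>x\<in>sphere 0 1. f x = harm_sum (harm_dim d l) Y a x)"


section \<open>Random coefficients\<close>

text \<open>The dimension of the coefficient space varies with the degree, so \<open>R^n\<close> is the space of
  extensional functions on \<open>{1..n}\<close>.\<close>

abbreviation lborel_coord :: "nat \<Rightarrow> (nat \<Rightarrow> real) measure" where
  "lborel_coord n \<equiv> Pi\<^sub>M {1..n} (\<lambda>_. lborel)"

definition coord_norm :: "nat \<Rightarrow> (nat \<Rightarrow> real) \<Rightarrow> real" where
  "coord_norm n a = sqrt (\<Sum>m=1..n. (a m)\<^sup>2)"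

definition coord_sphere :: "nat \<Rightarrow> (nat \<Rightarrow> real) set" where
  "coord_sphere n = {a \<in> space (lborel_coord n). coord_norm n a = 1}"

definition coord_ball :: "nat \<Rightarrow> (nat \<Rightarrow> real) set" where
  "coord_ball n = {a \<in> space (lborel_coord n). 0 < coord_norm n a \<and> coord_norm n a \<le> 1}"

text \<open>Normalized Lebesgue measure on the sphere of \<open>R^n\<close>, again by radial projection of the
  punctured ball, and completed so that all Lebesgue measurable sets are measured.\<close>

definition coord_sphere_measure :: "nat \<Rightarrow> (nat \<Rightarrow> real) measure" where
  "coord_sphere_measure n = completion (
     distr (uniform_measure (restrict_space (lborel_coord n) (coord_ball n)) (coord_ball n))
           (restrict_space (lborel_coord n) (coord_sphere n))
           (\<lambda>a. \<lambda>m\<in>{1..n}. a m / coord_norm n a))"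

text \<open>Centered Gaussian vector with covariance matrix \<open>v I\<close> (\<open>v > 0\<close>).\<close>

definition isotropic_gaussian ::
    "'w measure \<Rightarrow> nat \<Rightarrow> real \<Rightarrow> (nat \<Rightarrow> 'w \<Rightarrow> real) \<Rightarrow> bool" where
  "isotropic_gaussian M n v X \<longleftrightarrow>
     prob_space.indep_vars M (\<lambda>_. borel) X {1..n} \<and>
     (\<forall>m\<in>{1..n}. distributed M lborel (X m) (normal_density 0 (sqrt v)))"

text \<open>The variance with values in \<open>[0, \<infinity>]\<close>. The library's real-valued \<open>variance\<close> is \<open>0\<close> by
  convention when \<open>X\<close> is integrable but not square-integrable.\<close>

definition ext_variance :: "'w measure \<Rightarrow> ('w \<Rightarrow> real) \<Rightarrow> ennreal" where
  "ext_variance M X = (\<integral>\<^sup>+\<omega>. ennreal ((X \<omega> - integral\<^sup>L M X)\<^sup>2) \<partial>M)"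

lemma ext_variance_eq_variance:
  assumes "prob_space M" "integrable M X" "integrable M (\<lambda>\<omega>. (X \<omega>)\<^sup>2)"
  shows "ext_variance M X = ennreal (prob_space.variance M X)"
proof -
  interpret prob_space M by fact
  have "integrable M (\<lambda>\<omega>. (X \<omega> - expectation X)\<^sup>2)"
    using assms(2,3) by (simp add: power2_diff)
  then show ?thesis
    unfolding ext_variance_def by (intro nn_integral_eq_integral) auto
qed


section \<open>Excursion functionals\<close>

definition excursion_set :: "real \<Rightarrow> ('a::euclidean_space \<Rightarrow> real) \<Rightarrow> 'a set" where
  "excursion_set u f = {x \<in> sphere 0 1. f x \<ge> u}"

definition monotonic_functional :: "('a::euclidean_space set \<Rightarrow> real) \<Rightarrow> bool" where
  "monotonic_functional g \<longleftrightarrow>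
     mono_on (sets (restrict_space borel (sphere 0 1))) g \<or>
     antimono_on (sets (restrict_space borel (sphere 0 1))) g"

definition mean_excursion ::
    "'w measure \<Rightarrow> ('a::euclidean_space set \<Rightarrow> real) \<Rightarrow> ('w \<Rightarrow> 'a \<Rightarrow> real) \<Rightarrow> real \<Rightarrow> real" where
  "mean_excursion M g T u = (LINT \<omega>|M. g (excursion_set u (T \<omega>)))"

definition max_variance ::
    "'w measure \<Rightarrow> ('a::euclidean_space set \<Rightarrow> real) \<Rightarrow> ('w \<Rightarrow> 'a \<Rightarrow> real) \<Rightarrow> ennreal" where
  "max_variance M g T = (SUP u. ext_variance M (\<lambda>\<omega>. g (excursion_set u (T \<omega>))))"

definition derivative_bound :: "(nat \<Rightarrow> real \<Rightarrow> real) \<Rightarrow> real \<Rightarrow> bool" where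
  "derivative_bound \<Psi> c \<longleftrightarrow> (\<forall>l\<ge>1. \<forall>u. \<bar>deriv (\<Psi> l) u\<bar> \<le> c / (1 + \<bar>u\<bar>))"

text \<open>Families are indexed by degrees \<open>l \<ge> 1\<close>; the values at \<open>l = 0\<close> are irrelevant.\<close>

definition regular_family ::
    "'w measure \<Rightarrow> (nat \<Rightarrow> 'a::euclidean_space set \<Rightarrow> real) \<Rightarrow> (nat \<Rightarrow> 'w \<Rightarrow> 'a \<Rightarrow> real) \<Rightarrow> bool"
  where
  "regular_family M g T \<longleftrightarrow>
     (\<forall>l\<ge>1. monotonic_functional (g l)) \<and>
     (\<forall>l\<ge>1. \<forall>u. integrable M (\<lambda>\<omega>. g l (excursion_set u (T l \<omega>)))) \<and>
     (\<exists>\<Psi>. \<forall>u. (\<lambda>l. mean_excursion M (g l) (T l) u) \<longlonglongrightarrow> \<Psi> u) \<and>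
     (\<forall>l\<ge>1. \<forall>u. mean_excursion M (g l) (T l) differentiable at u) \<and>
     (\<exists>c>0. derivative_bound (\<lambda>l. mean_excursion M (g l) (T l)) c) \<and>
     (\<lambda>l. max_variance M (g l) (T l) / of_nat l) \<longlonglongrightarrow> 0"

definition deviation_set ::
    "nat \<Rightarrow> (nat \<Rightarrow> 'a::euclidean_space \<Rightarrow> real) \<Rightarrow> ('a set \<Rightarrow> real) \<Rightarrow> (real \<Rightarrow> real) \<Rightarrow>
     real \<Rightarrow> real \<Rightarrow> (nat \<Rightarrow> real) set" where
  "deviation_set n Y g \<psi> \<epsilon> u =
     {a \<in> coord_sphere n. \<bar>g (excursion_set u (harm_sum n Y a)) - \<psi> u\<bar> > \<epsilon>}"

end

theory Submission
  imports Defs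
begin

text \<open>
  Fix a degree and write the Gaussian coefficient vector as \<open>R \<theta>\<close>, where \<open>\<theta>\<close> is uniform on the
  unit sphere of \<open>R^n\<close> and independent of \<open>R\<close> (\<open>dir_radius_independent\<close>). The condition
  \<open>R h \<ge> w\<close> is the condition \<open>h \<ge> w / R\<close>, so the functional of the Gaussian field at level \<open>w\<close>
  is the functional of the random harmonic \<open>h\<close> with coefficients \<open>\<theta>\<close> at the random level
  \<open>w / R\<close>.

  The functional is monotone in the level. Let \<open>r\<close> be a median of \<open>R\<close> and \<open>w = r u\<close>. Then
  \<open>w / R\<close> is above \<open>u\<close> with probability at least one half, below \<open>u\<close> with probability at least
  one half, and both events are independent of \<open>\<theta>\<close>. So whenever the functional of \<open>h\<close> at level
  \<open>u\<close> exceeds \<open>\<Psi> u\<close> by more than \<open>\<epsilon>\<close>, the Gaussian functional at level \<open>r u\<close> does so too with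
  conditional probability at least one half, and the same holds for the lower tail. As the two
  tails are disjoint, \<open>\<mu> (\<bar>g (h, u) - \<Psi> u\<bar> > \<epsilon>) \<le> 2 P (\<bar>g (T, r u) - \<Psi> u\<bar> > \<epsilon>)\<close>
  (\<open>sphere_deviation_le_gaussian_deviation\<close>); here the factor \<open>2\<close> of the theorem arises.

  To apply Chebyshev's inequality, \<open>\<Psi> u\<close> must be replaced by the mean \<open>\<Psi> (r u)\<close>. The derivative
  bound makes \<open>\<Psi>\<close> Lipschitz in the logarithm of the level, hence the error is at most
  \<open>c ln (1 / r)\<close> (\<open>derivative_bound_imp_log_Lipschitz\<close>). The median of \<open>R\<close> lies between the mode
  \<open>sqrt ((n - 1) / n)\<close> and \<open>1\<close> (\<open>cdf_mode_le_half\<close>, \<open>half_le_cdf_1\<close>), so that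
  \<open>ln (1 / r) \<le> 1 / n\<close> (\<open>radius_median\<close>). Chebyshev's inequality with \<open>\<epsilon> - c / n\<close> in place of
  \<open>\<epsilon>\<close> gives the theorem after an elementary computation (\<open>chebyshev_bound_absorbs_shift\<close>),
  because a bound that says anything at all forces \<open>\<epsilon>\<^sup>2\<close> to exceed \<open>2 (1 + c) (1 / n + \<sigma>\<^sup>2)\<close>.
\<close>

section \<open>The median of a normalized chi distribution\<close>

lemma one_minus_times_exp_le:
  fixes s :: real
  assumes "0 \<le> s"
  shows "(1 - s) * exp s \<le> (1 + s) * exp (- s)"
proof -
  have "(1 + 0) * exp (- 0) - (1 - 0) * exp (0::real) \<le> (1 + s) * exp (- s) - (1 - s) * exp s"
  proof (rule DERIV_nonneg_imp_nondecreasing[OF assms])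
    fix x :: real
    assume "0 \<le> x"
    have "((\<lambda>s. (1 + s) * exp (- s) - (1 - s) * exp s) has_real_derivative
        x * (exp x - exp (- x))) (at x)"
      by (auto intro!: derivative_eq_intros simp: algebra_simps)
    moreover have "0 \<le> x * (exp x - exp (- x))"
      using \<open>0 \<le> x\<close> by simp
    ultimately show "\<exists>y. ((\<lambda>s. (1 + s) * exp (- s) - (1 - s) * exp s) has_real_derivative y) (at x)
        \<and> 0 \<le> y"
      by blast
  qed
  then show ?thesis by simp
qed

lemma two_times_le_exp_diff:
  fixes x :: real
  assumes "0 \<le> x"
  shows "2 * x \<le> exp x - exp (- x)"
proof -
  have "exp 0 - exp (- 0) - 2 * 0 \<le> exp x - exp (- x) - 2 * x"
  proof (rule DERIV_nonneg_imp_nondecreasing[OF assms])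
    fix y :: real
    have "((\<lambda>x. exp x - exp (- x) - 2 * x) has_real_derivative (exp (y/2) - exp (- y/2))\<^sup>2) (at y)"
      by (auto intro!: derivative_eq_intros simp: power2_eq_square algebra_simps simp flip: exp_add)
    then show "\<exists>z. ((\<lambda>x. exp x - exp (- x) - 2 * x) has_real_derivative z) (at y) \<and> 0 \<le> z"
      using zero_le_power2 by blast
  qed
  then show ?thesis by simp
qed

text \<open>\<open>F\<close> stands for the distribution function of the Euclidean norm of a centered Gaussian vector
  in \<open>R^n\<close> with covariance \<open>I/n\<close>, and \<open>f\<close> for its density with normalizing constant \<open>k\<close>. The
  assumptions collect what calculus needs to locate the median.\<close>

locale normalized_chi_cdf =
  fixes n :: nat and k :: real and f F :: "real \<Rightarrow> real"
  assumes n: "n \<ge> 2" and k: "k \<ge> 0"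
    and f_def: "\<And>s. f s = k * s ^ (n - 1) * exp (- (real n * s\<^sup>2 / 2))"
    and deriv: "\<And>s. s > 0 \<Longrightarrow> (F has_real_derivative f s) (at s)"
    and cont: "continuous_on {0..} F"
    and zero: "F 0 = 0"
    and range: "\<And>s. 0 \<le> F s" "\<And>s. F s \<le> 1"
    and lim: "(F \<longlongrightarrow> 1) at_top"
begin

text \<open>On the scale \<open>ln s\<close> the density is \<open>k exp (n t - n exp (2 t) / 2)\<close>, with its peak at \<open>0\<close>. It
  decays faster to the right than to the left because \<open>2 t \<le> sinh (2 t)\<close> for \<open>t \<ge> 0\<close>, so the
  right of \<open>0\<close> carries the smaller mass. The comparison of masses is expressed by the
  monotonicity of \<open>F (exp t) + F (exp (- t))\<close>.\<close>

lemma half_le_cdf_1: "1 / 2 \<le> F 1"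
proof -
  have *: "F (exp t) \<le> 2 * F 1" if "t \<ge> 0" for t
  proof -
    have "F (exp 0) + F (exp (- 0)) \<ge> F (exp t) + F (exp (- t))"
    proof (rule DERIV_nonpos_imp_nonincreasing[OF that])
      fix x :: real
      assume x: "0 \<le> x"
      have e: "exp y * f (exp y) = k * exp (real n * y - real n * exp (2 * y) / 2)" for y
      proof -
        have "exp y * exp y ^ (n - 1) = exp (real n * y)"
          using n by (metis One_nat_def Suc_pred exp_of_nat_mult less_le_trans pos2 power_Suc)
        moreover have "(exp y)\<^sup>2 = exp (2 * y)"
          by (simp flip: exp_of_nat_mult)
        moreover have "exp (real n * y - real n * exp (2 * y) / 2)
            = exp (real n * y) * exp (- (real n * exp (2 * y) / 2))"
          by (simp flip: exp_add)
        ultimately show ?thesis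
          by (simp add: f_def mult_ac)
      qed
      have "((\<lambda>t. F (exp t) + F (exp (- t))) has_real_derivative
          exp x * f (exp x) - exp (- x) * f (exp (- x))) (at x)"
        by (auto intro!: derivative_eq_intros DERIV_chain2[OF deriv] simp: algebra_simps)
      moreover have "exp x * f (exp x) \<le> exp (- x) * f (exp (- x))"
      proof -
        have "real n * (2 * (2 * x)) \<le> real n * (exp (2 * x) - exp (- (2 * x)))"
          using two_times_le_exp_diff[of "2 * x"] x by (intro mult_left_mono) auto
        then have "real n * x - real n * exp (2 * x) / 2
            \<le> real n * (- x) - real n * exp (2 * (- x)) / 2"
          by (simp add: algebra_simps)
        then show ?thesis
          unfolding e using k by (intro mult_left_mono) auto
      qed
      ultimately show "\<exists>y. ((\<lambda>t. F (exp t) + F (exp (- t))) has_real_derivative y) (at x) \<and> y \<le> 0"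
        by (metis diff_le_0_iff_le)
    qed
    then show ?thesis
      using range(1)[of "exp (- t)"] by simp
  qed
  have "((\<lambda>t. F (exp t)) \<longlongrightarrow> 1) at_top"
    by (rule filterlim_compose[OF lim exp_at_top])
  then have "1 \<le> 2 * F 1"
    by (rule tendsto_upperbound) (auto intro!: eventually_mono[OF eventually_ge_at_top[of 0]] *)
  then show ?thesis by simp
qed

text \<open>The point \<open>m = sqrt ((n - 1) / n)\<close> is the mode of \<open>f\<close>. Reflection at \<open>m\<close> shows that \<open>f\<close> is
  larger on the right: with \<open>t = m s\<close>, the relation \<open>n m\<^sup>2 = n - 1\<close> turns
  \<open>f (m - t) \<le> f (m + t)\<close> into the \<open>(n - 1)\<close>-st power of \<open>one_minus_times_exp_le\<close>. Hence the
  interval \<open>{m..2 m}\<close> has at least the mass of \<open>{0..m}\<close>.\<close>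

lemma cdf_mode_le_half: "F (sqrt ((real n - 1) / real n)) \<le> 1 / 2"
proof -
  define m where "m = sqrt ((real n - 1) / real n)"
  have m: "m > 0" and m2: "real n * m\<^sup>2 = real n - 1"
    using n by (auto simp: m_def)
  have "F (m + 0) + F (m - 0) \<le> F (m + m) + F (m - m)"
  proof (rule DERIV_nonneg_imp_increasing_open[where f = "\<lambda>t. F (m + t) + F (m - t)"])
    fix t assume t: "0 < t" "t < m"
    define s where "s = t / m"
    have s: "0 \<le> s" "s < 1" "t = m * s"
      using t m by (auto simp: s_def)
    have "f (m - t) \<le> f (m + t)"
    proof -
      have w: "((1 - s) * exp s) ^ (n - 1) \<le> ((1 + s) * exp (- s)) ^ (n - 1)"
        using one_minus_times_exp_le[of s] s by (intro power_mono) auto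
      have "f (m - t) = k * m ^ (n - 1) * exp (- (real n * (m\<^sup>2 + t\<^sup>2) / 2))
          * ((1 - s) * exp s) ^ (n - 1)"
      proof -
        have "- (real n * (m - t)\<^sup>2 / 2) = - (real n * (m\<^sup>2 + t\<^sup>2) / 2) + (real n * m\<^sup>2) * s"
          unfolding s(3) by algebra
        also have "\<dots> = - (real n * (m\<^sup>2 + t\<^sup>2) / 2) + real (n - 1) * s"
          using n unfolding m2 by (simp add: of_nat_diff)
        finally have "exp (- (real n * (m - t)\<^sup>2 / 2))
            = exp (- (real n * (m\<^sup>2 + t\<^sup>2) / 2)) * exp s ^ (n - 1)"
          by (simp only: exp_add exp_of_nat_mult)
        moreover have "m - t = m * (1 - s)"
          by (simp add: s(3) algebra_simps)
        ultimately show ?thesis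
          by (simp add: f_def power_mult_distrib)
      qed
      also have "\<dots> \<le> k * m ^ (n - 1) * exp (- (real n * (m\<^sup>2 + t\<^sup>2) / 2))
          * ((1 + s) * exp (- s)) ^ (n - 1)"
        using w k m by (intro mult_left_mono) auto
      also have "\<dots> = f (m + t)"
      proof -
        have "- (real n * (m + t)\<^sup>2 / 2) = - (real n * (m\<^sup>2 + t\<^sup>2) / 2) + (real n * m\<^sup>2) * (- s)"
          unfolding s(3) by algebra
        also have "\<dots> = - (real n * (m\<^sup>2 + t\<^sup>2) / 2) + real (n - 1) * (- s)"
          using n unfolding m2 by (simp add: of_nat_diff)
        finally have "exp (- (real n * (m + t)\<^sup>2 / 2))
            = exp (- (real n * (m\<^sup>2 + t\<^sup>2) / 2)) * exp (- s) ^ (n - 1)"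
          by (simp only: exp_add exp_of_nat_mult)
        moreover have "m + t = m * (1 + s)"
          by (simp add: s(3) algebra_simps)
        ultimately show ?thesis
          by (simp add: f_def power_mult_distrib)
      qed
      finally show ?thesis .
    qed
    moreover have "((\<lambda>t. F (m + t) + F (m - t)) has_real_derivative f (m + t) - f (m - t)) (at t)"
      using t m by (auto intro!: derivative_eq_intros DERIV_chain2[OF deriv])
    ultimately show "\<exists>y. ((\<lambda>t. F (m + t) + F (m - t)) has_real_derivative y) (at t) \<and> 0 \<le> y"
      by (metis diff_ge_0_iff_ge)
  next
    show "continuous_on {0..m} (\<lambda>t. F (m + t) + F (m - t))"
      using m by (auto intro!: continuous_intros continuous_on_compose2[OF cont])
  qed (use m in simp)
  then show ?thesis
    using range(2)[of "m + m"] by (simp add: zero flip: m_def)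
qed

lemma median_exists:
  obtains r where "sqrt ((real n - 1) / real n) \<le> r" "r \<le> 1" "F r = 1 / 2"
proof -
  have "sqrt ((real n - 1) / real n) \<le> 1" using n by simp
  moreover have "0 \<le> sqrt ((real n - 1) / real n)" using n by simp
  ultimately show thesis
    using IVT'[of F "sqrt ((real n - 1) / real n)" "1/2" 1] half_le_cdf_1 cdf_mode_le_half that
      continuous_on_subset[OF cont]
    by (metis atLeastAtMost_iff atLeast_iff order_trans subsetI)
qed

end

section \<open>Volumes of cones and the uniform measure on the sphere\<close>

text \<open>The index sets \<open>{1..n}\<close> keep this form, in which all facts about them are stated, only if \<open>1\<close>
  is not unfolded to \<open>Suc 0\<close>.\<close>

declare One_nat_def [simp del]

definition coord_dir :: "nat \<Rightarrow> (nat \<Rightarrow> real) \<Rightarrow> nat \<Rightarrow> real" where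
  "coord_dir n a = (\<lambda>m\<in>{1..n}. a m / coord_norm n a)"

definition cone :: "nat \<Rightarrow> (nat \<Rightarrow> real) set \<Rightarrow> (nat \<Rightarrow> real) set" where
  "cone n A = {a \<in> space (lborel_coord n). 0 < coord_norm n a \<and> coord_dir n a \<in> A}"

definition cone_volume :: "nat \<Rightarrow> (nat \<Rightarrow> real) set \<Rightarrow> ennreal" where
  "cone_volume n A = emeasure (lborel_coord n) {a \<in> cone n A. coord_norm n a \<le> 1}"

lemma coord_norm_measurable [measurable]: "coord_norm n \<in> borel_measurable (lborel_coord n)"
  unfolding coord_norm_def by measurable

lemma coord_dir_measurable [measurable]:
  "coord_dir n \<in> measurable (lborel_coord n) (lborel_coord n)"
  unfolding coord_dir_def by measurable

lemma coord_norm_nonneg [simp]: "0 \<le> coord_norm n a"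
  by (simp add: coord_norm_def sum_nonneg)

lemma coord_norm_restrict [simp]: "coord_norm n (restrict a {1..n}) = coord_norm n a"
  by (simp add: coord_norm_def)

lemma coord_norm_scale: "coord_norm n (\<lambda>m. s * a m) = \<bar>s\<bar> * coord_norm n a"
  by (simp add: coord_norm_def power_mult_distrib real_sqrt_mult flip: sum_distrib_left)

lemma coord_norm_dir: "0 < coord_norm n a \<Longrightarrow> coord_norm n (coord_dir n a) = 1"
  using coord_norm_scale[of n "1 / coord_norm n a" a] by (simp add: coord_dir_def)

lemma coord_dir_scale:
  "0 < s \<Longrightarrow> coord_dir n (\<lambda>m\<in>{1..n}. s * a m) = coord_dir n a"
  using coord_norm_scale[of n s a] by (simp add: coord_dir_def fun_eq_iff)

lemma coord_sphere_measurable [measurable]: "coord_sphere n \<in> sets (lborel_coord n)"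
  unfolding coord_sphere_def by measurable

lemma sets_restrict_coord_sphereD:
  assumes "A \<in> sets (restrict_space (lborel_coord n) (coord_sphere n))"
  shows "A \<in> sets (lborel_coord n)" "A \<subseteq> coord_sphere n"
proof -
  have "coord_sphere n \<inter> space (lborel_coord n) \<in> sets (lborel_coord n)"
    by simp
  from sets_restrict_space_iff[OF this] assms
  show "A \<in> sets (lborel_coord n)" "A \<subseteq> coord_sphere n"
    by blast+
qed

lemma cone_measurable [measurable]:
  assumes "A \<in> sets (lborel_coord n)"
  shows "cone n A \<in> sets (lborel_coord n)"
proof -
  have "cone n A = {a \<in> space (lborel_coord n). 0 < coord_norm n a} \<inter>
      (coord_dir n -` A \<inter> space (lborel_coord n))"
    by (auto simp: cone_def)
  also have "\<dots> \<in> sets (lborel_coord n)"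
    using measurable_sets[OF coord_dir_measurable assms] by (rule sets.Int[rotated]) measurable
  finally show ?thesis .
qed

lemma coord_dir_in_sphere:
  assumes "0 < coord_norm n a"
  shows "coord_dir n a \<in> coord_sphere n"
  using coord_norm_dir[OF assms] by (auto simp: coord_sphere_def coord_dir_def space_PiM)

text \<open>Lebesgue measure on \<open>R^n\<close> is a product measure, so the scaling law is inherited from the real
  line factor by factor.\<close>

lemma lborel_coord_scale:
  assumes s: "0 < s"
  shows "lborel_coord n =
    scale_measure (ennreal (s ^ n)) (distr (lborel_coord n) (lborel_coord n) (\<lambda>a. \<lambda>m\<in>{1..n}. s * a m))"
proof -
  interpret product_sigma_finite "\<lambda>_::nat. lborel :: real measure"
    by standard
  let ?L = "lborel_coord n" and ?S = "\<lambda>a. \<lambda>m\<in>{1..n}. s * a m"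
  have meas: "?S \<in> measurable ?L ?L"
    by measurable
  show ?thesis
  proof (rule PiM_eqI[symmetric])
    fix A :: "nat \<Rightarrow> real set"
    assume A: "\<And>i. i \<in> {1..n} \<Longrightarrow> A i \<in> sets lborel"
    have pre: "((*) s -` A i) \<in> sets lborel" if "i \<in> {1..n}" for i
      using measurable_sets[of "(*) s" borel borel "A i"] A[OF that] by simp
    have scaled: "emeasure lborel ((*) s -` A i) = ennreal (1 / s) * emeasure lborel (A i)"
      if "i \<in> {1..n}" for i
    proof -
      have "emeasure lborel ((*) s -` A i) = emeasure (distr lborel borel ((*) s)) (A i)"
        using A[OF that] by (subst emeasure_distr) auto
      also have "\<dots> = ennreal (1 / s) * emeasure lborel (A i)"
        using A[OF that] s
        by (simp add: lborel_distr_mult emeasure_density nn_integral_cmult divide_inverse)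
      finally show ?thesis .
    qed
    have "emeasure (distr ?L ?L ?S) (Pi\<^sub>E {1..n} A) = emeasure ?L (Pi\<^sub>E {1..n} (\<lambda>i. (*) s -` A i))"
    proof -
      have "Pi\<^sub>E {1..n} A \<in> sets ?L"
        using A by (intro sets_PiM_I_finite) auto
      moreover have "?S -` Pi\<^sub>E {1..n} A \<inter> space ?L = Pi\<^sub>E {1..n} (\<lambda>i. (*) s -` A i)"
        by (auto simp: space_PiM PiE_iff)
      ultimately show ?thesis
        by (simp add: emeasure_distr[OF meas])
    qed
    also have "\<dots> = (\<Prod>i\<in>{1..n}. emeasure lborel ((*) s -` A i))"
      using pre by (intro emeasure_PiM) auto
    also have "\<dots> = (\<Prod>i\<in>{1..n}. ennreal (1 / s) * emeasure lborel (A i))"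
      by (intro prod.cong scaled refl)
    also have "\<dots> = ennreal ((1 / s) ^ n) * (\<Prod>i\<in>{1..n}. emeasure lborel (A i))"
      using s by (simp add: prod.distrib ennreal_power)
    finally have "emeasure (distr ?L ?L ?S) (Pi\<^sub>E {1..n} A)
        = ennreal ((1 / s) ^ n) * (\<Prod>i\<in>{1..n}. emeasure lborel (A i))" .
    moreover have "ennreal (s ^ n) * ennreal ((1 / s) ^ n) = 1"
      using s by (simp flip: ennreal_mult power_mult_distrib)
    ultimately show "emeasure (scale_measure (ennreal (s ^ n)) (distr ?L ?L ?S)) (Pi\<^sub>E {1..n} A)
        = (\<Prod>i\<in>{1..n}. emeasure lborel (A i))"
      by (simp flip: mult.assoc)
  qed auto
qed

lemma emeasure_cone_ball:
  assumes [measurable]: "A \<in> sets (lborel_coord n)" and s: "0 < s"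
  shows "emeasure (lborel_coord n) {a \<in> cone n A. coord_norm n a \<le> s} = ennreal (s ^ n) * cone_volume n A"
proof -
  let ?L = "lborel_coord n" and ?S = "\<lambda>a. \<lambda>m\<in>{1..n}. s * a m"
  let ?X = "{a \<in> cone n A. coord_norm n a \<le> s}"
  have sets: "?X \<in> sets ?L"
  proof -
    have "?X = cone n A \<inter> {a \<in> space ?L. coord_norm n a \<le> s}"
      by (auto simp: cone_def)
    then show ?thesis by simp
  qed
  have pre: "?S -` ?X \<inter> space ?L = {a \<in> cone n A. coord_norm n a \<le> 1}"
    using s by (auto simp: cone_def coord_norm_scale coord_dir_scale space_PiM zero_less_mult_iff)
  have "emeasure ?L ?X = emeasure (scale_measure (ennreal (s ^ n)) (distr ?L ?L ?S)) ?X"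
    by (subst lborel_coord_scale[OF s]) simp
  also have "\<dots> = ennreal (s ^ n) * emeasure ?L (?S -` ?X \<inter> space ?L)"
    using sets by (simp add: emeasure_distr)
  finally show ?thesis
    unfolding pre cone_volume_def .
qed

lemma cone_sphere: "cone n (coord_sphere n) = {a \<in> space (lborel_coord n). 0 < coord_norm n a}"
  using coord_dir_in_sphere by (auto simp: cone_def)

lemma cone_volume_le:
  assumes "A \<in> sets (lborel_coord n)" "A \<subseteq> coord_sphere n"
  shows "cone_volume n A \<le> cone_volume n (coord_sphere n)"
proof -
  have "{a \<in> cone n (coord_sphere n). coord_norm n a \<le> 1} =
      cone n (coord_sphere n) \<inter> {a \<in> space (lborel_coord n). coord_norm n a \<le> 1}"
    by (auto simp: cone_def)
  then have "{a \<in> cone n (coord_sphere n). coord_norm n a \<le> 1} \<in> sets (lborel_coord n)"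
    by simp
  then show ?thesis
    unfolding cone_volume_def using assms(2)
    by (intro emeasure_mono) (auto simp: cone_def)
qed

lemma cone_volume_sphere_finite: "cone_volume n (coord_sphere n) < \<infinity>"
proof -
  have "cone_volume n (coord_sphere n) \<le> emeasure (lborel_coord n)
      ({a. sqrt (\<Sum>i\<in>{1..n}. (a i)\<^sup>2) \<le> 1} \<inter> space (lborel_coord n))"
    unfolding cone_volume_def by (intro emeasure_mono) (auto simp: cone_def coord_norm_def)
  also have "\<dots> = ennreal (unit_ball_vol (real n))"
    by (subst emeasure_cball_aux) auto
  finally show ?thesis
    using le_less_trans by fastforce
qed

lemma emeasure_coord_norm_zero:
  assumes "0 < n"
  shows "{a \<in> space (lborel_coord n). coord_norm n a = 0} \<in> null_sets (lborel_coord n)"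
proof -
  interpret product_sigma_finite "\<lambda>_::nat. lborel :: real measure"
    by standard
  have eq: "{a \<in> space (lborel_coord n). coord_norm n a = 0} = Pi\<^sub>E {1..n} (\<lambda>_. {0})"
    by (auto simp: coord_norm_def space_PiM PiE_iff sum_nonneg_eq_0_iff extensional_def fun_eq_iff)
  have "emeasure (lborel_coord n) (Pi\<^sub>E {1..n} (\<lambda>_. {0})) = 0"
    using assms by (subst emeasure_PiM) auto
  moreover have "{a \<in> space (lborel_coord n). coord_norm n a = 0} \<in> sets (lborel_coord n)"
    by measurable
  ultimately show ?thesis
    unfolding eq by auto
qed

text \<open>For \<open>n = 0\<close> the punctured ball is empty; for \<open>n > 0\<close> the puncture is a null set.\<close>

lemma cone_volume_sphere_pos:
  assumes "0 < n"
  shows "0 < cone_volume n (coord_sphere n)"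
proof -
  let ?L = "lborel_coord n"
  let ?B = "{a \<in> space ?L. coord_norm n a \<le> 1}" and ?Z = "{a \<in> space ?L. coord_norm n a = 0}"
  have eq: "{a \<in> cone n (coord_sphere n). coord_norm n a \<le> 1} = ?B - ?Z"
    using coord_norm_nonneg[of n] by (auto simp: cone_sphere less_le)
  have "?B = {a. (\<Sum>i\<in>{1..n}. (a i)\<^sup>2) \<le> 1} \<inter> space ?L"
    by (auto simp: coord_norm_def)
  then have "emeasure ?L ?B = ennreal (unit_ball_vol (real n))"
    using emeasure_cball_aux[of "{1..n}" 1] by simp
  moreover have "emeasure ?L (?B - ?Z) = emeasure ?L ?B"
    by (intro emeasure_Diff_null_set emeasure_coord_norm_zero assms) measurable
  ultimately show ?thesis
    by (simp add: cone_volume_def eq)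
qed

text \<open>A cone meets the ball of radius \<open>s\<close> in volume \<open>s\<^sup>n\<close> times the volume for radius \<open>1\<close>. So up to
  the factor \<open>cone_volume n A\<close> the distribution of the radius does not depend on the cone, and
  it has density \<open>n s^(n - 1)\<close>.\<close>

lemma distr_norm_cone:
  assumes n: "0 < n" and A: "A \<in> sets (lborel_coord n)" "A \<subseteq> coord_sphere n"
  shows "distr (density (lborel_coord n) (indicator (cone n A))) borel (coord_norm n) =
    density lborel (\<lambda>s. cone_volume n A * (ennreal (real n * s ^ (n - 1)) * indicator {0<..} s))"
    (is "?N = ?D")
proof -
  let ?L = "lborel_coord n"
  note [measurable] = A(1)
  have N: "emeasure ?N {..x} = (if 0 < x then ennreal (x ^ n) * cone_volume n A else 0)" for x
  proof -
    have "emeasure ?N {..x} = emeasure (density ?L (indicator (cone n A))) (coord_norm n -` {..x} \<inter> space ?L)"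
      by (subst emeasure_distr) auto
    also have "\<dots> = emeasure ?L (cone n A \<inter> (coord_norm n -` {..x} \<inter> space ?L))"
      by (subst emeasure_density) (auto simp flip: indicator_inter_arith)
    also have "cone n A \<inter> (coord_norm n -` {..x} \<inter> space ?L) = {a \<in> cone n A. coord_norm n a \<le> x}"
      by (auto simp: cone_def)
    finally have eq: "emeasure ?N {..x} = emeasure ?L {a \<in> cone n A. coord_norm n a \<le> x}" .
    show ?thesis
    proof (cases "0 < x")
      case True
      with emeasure_cone_ball[OF A(1)] show ?thesis by (simp add: eq)
    next
      case False
      then have "{a \<in> cone n A. coord_norm n a \<le> x} = {}"
        by (auto simp: cone_def)
      with False show ?thesis by (simp only: eq emeasure_empty if_False)
    qed
  qed
  have D: "emeasure ?D {..x} = (if 0 < x then ennreal (x ^ n) * cone_volume n A else 0)" for x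
  proof -
    have "emeasure ?D {..x} = (\<integral>\<^sup>+s. cone_volume n A *
        (ennreal (real n * s ^ (n - 1)) * indicator {0<..} s) * indicator {..x} s \<partial>lborel)"
      by (subst emeasure_density) auto
    also have "\<dots> = (if 0 < x then ennreal (x ^ n) * cone_volume n A else 0)"
    proof (cases "0 < x")
      case True
      have "(\<integral>\<^sup>+s. cone_volume n A *
          (ennreal (real n * s ^ (n - 1)) * indicator {0<..} s) * indicator {..x} s \<partial>lborel) =
          (\<integral>\<^sup>+s. cone_volume n A * (ennreal (real n * s ^ (n - 1)) * indicator {0..x} s) \<partial>lborel)"
        by (intro nn_integral_cong_AE AE_I[of _ _ "{0}"]) (auto simp: indicator_def)
      also have "\<dots> = cone_volume n A * (\<integral>\<^sup>+s. ennreal (real n * s ^ (n - 1)) * indicator {0..x} s \<partial>lborel)"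
        by (intro nn_integral_cmult) auto
      also have "(\<integral>\<^sup>+s. ennreal (real n * s ^ (n - 1)) * indicator {0..x} s \<partial>lborel) = x ^ n - 0 ^ n"
        using True by (intro nn_integral_FTC_Icc) (auto intro!: derivative_eq_intros simp: One_nat_def)
      finally show ?thesis
        using True n by (simp add: mult.commute zero_power)
    next
      case False
      then have "(\<lambda>s. cone_volume n A *
          (ennreal (real n * s ^ (n - 1)) * indicator {0<..} s) * indicator {..x} s) = (\<lambda>_. 0)"
        by (auto simp: indicator_def fun_eq_iff)
      with False show ?thesis by simp
    qed
    finally show ?thesis .
  qed
  show ?thesis
  proof (rule measure_eqI_generator_eq[where E = "range atMost" and \<Omega> = UNIV and A = "\<lambda>i. {..real i}"])
    show "Int_stable (range (atMost :: real \<Rightarrow> _))"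
      by (auto simp: Int_stable_def)
    show "sets ?N = sigma_sets UNIV (range atMost)" "sets ?D = sigma_sets UNIV (range atMost)"
      by (simp_all add: borel_eq_atMost)
    show "(\<Union>i. {..real i}) = UNIV"
      by (auto intro: real_arch_simple)
    show "emeasure ?N {..real i} \<noteq> \<infinity>" for i
      using cone_volume_sphere_finite[of n] cone_volume_le[OF A]
      by (auto simp: N ennreal_mult_eq_top_iff simp del: ennreal_power)
  qed (auto simp: N D)
qed

lemma nn_integral_cone:
  assumes n: "0 < n" and A: "A \<in> sets (lborel_coord n)" "A \<subseteq> coord_sphere n"
    and [measurable]: "h \<in> borel_measurable borel"
  shows "(\<integral>\<^sup>+a. h (coord_norm n a) * indicator (cone n A) a \<partial>lborel_coord n) =
    cone_volume n A * (\<integral>\<^sup>+s. h s * (ennreal (real n * s ^ (n - 1)) * indicator {0<..} s) \<partial>lborel)"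
proof -
  note [measurable] = A(1)
  have "(\<integral>\<^sup>+a. h (coord_norm n a) * indicator (cone n A) a \<partial>lborel_coord n) =
      (\<integral>\<^sup>+a. h (coord_norm n a) \<partial>density (lborel_coord n) (indicator (cone n A)))"
    by (subst nn_integral_density) (auto simp: mult.commute)
  also have "\<dots> = (\<integral>\<^sup>+s. h s \<partial>distr (density (lborel_coord n) (indicator (cone n A))) borel (coord_norm n))"
    by (subst nn_integral_distr) auto
  also have "\<dots> = (\<integral>\<^sup>+s. cone_volume n A * (h s * (ennreal (real n * s ^ (n - 1)) * indicator {0<..} s)) \<partial>lborel)"
    unfolding distr_norm_cone[OF n A] by (subst nn_integral_density) (auto simp: mult_ac)
  also have "\<dots> = cone_volume n A * (\<integral>\<^sup>+s. h s * (ennreal (real n * s ^ (n - 1)) * indicator {0<..} s) \<partial>lborel)"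
    by (intro nn_integral_cmult) auto
  finally show ?thesis .
qed

text \<open>The formula is for Borel sets, because the cone over a set that is merely measurable for the
  completion need not be Borel.\<close>

lemma emeasure_coord_sphere_measure:
  assumes A: "A \<in> sets (restrict_space (lborel_coord n) (coord_sphere n))"
  shows "emeasure (coord_sphere_measure n) A = cone_volume n A / cone_volume n (coord_sphere n)"
proof -
  let ?L = "lborel_coord n" and ?S = "restrict_space (lborel_coord n) (coord_sphere n)"
  let ?B = "restrict_space (lborel_coord n) (coord_ball n)"
  note A' = sets_restrict_coord_sphereD[OF A]
  note [measurable] = A'(1)
  have ball [measurable]: "coord_ball n \<in> sets ?L"
    unfolding coord_ball_def by measurable
  have ball_cone: "coord_ball n = {a \<in> cone n (coord_sphere n). coord_norm n a \<le> 1}"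
    by (auto simp: coord_ball_def cone_sphere)
  have dir: "coord_dir n \<in> measurable ?B ?S"
    by (intro measurable_restrict_space3) (auto simp: coord_ball_def coord_dir_in_sphere)
  have ballB: "coord_ball n \<in> sets ?B"
    by (auto simp: sets_restrict_space_iff)
  have pre: "coord_dir n -` A \<inter> space ?B = {a \<in> cone n A. coord_norm n a \<le> 1}"
    using sets.sets_into_space[OF ball] by (auto simp: space_restrict_space cone_def coord_ball_def)
  have preB: "coord_dir n -` A \<inter> space ?B \<in> sets ?B"
    by (rule measurable_sets[OF dir A])
  have sub: "coord_ball n \<inter> (coord_dir n -` A \<inter> space ?B) = coord_dir n -` A \<inter> space ?B"
    by (auto simp: space_restrict_space)
  have eq: "coord_sphere_measure n = completion (distr (uniform_measure ?B (coord_ball n)) ?S (coord_dir n))"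
    by (simp add: coord_sphere_measure_def coord_dir_def[abs_def])
  have "emeasure (coord_sphere_measure n) A = emeasure (uniform_measure ?B (coord_ball n)) (coord_dir n -` A \<inter> space ?B)"
    unfolding eq using A dir
    by (subst emeasure_completion) (auto simp: emeasure_distr)
  also have "\<dots> = emeasure ?B (coord_dir n -` A \<inter> space ?B) / emeasure ?B (coord_ball n)"
    unfolding emeasure_uniform_measure[OF ballB preB] sub ..
  also have "\<dots> = emeasure ?L {a \<in> cone n A. coord_norm n a \<le> 1} / emeasure ?L (coord_ball n)"
    unfolding pre by (subst (1 2) emeasure_restrict_space) (auto simp: coord_ball_def cone_def)
  finally show ?thesis
    by (simp add: cone_volume_def ball_cone)
qed

lemma emeasure_coord_sphere_measure_le_1:
  assumes "0 < n"
  shows "emeasure (coord_sphere_measure n) S \<le> 1"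
proof -
  have sp: "space (coord_sphere_measure n) = coord_sphere n"
    by (simp add: coord_sphere_measure_def space_restrict_space coord_sphere_def)
  have "emeasure (coord_sphere_measure n) S \<le> emeasure (coord_sphere_measure n) (space (coord_sphere_measure n))"
    by (rule emeasure_space)
  also have "\<dots> = cone_volume n (coord_sphere n) / cone_volume n (coord_sphere n)"
    unfolding sp by (intro emeasure_coord_sphere_measure) (auto simp: sets_restrict_space_iff)
  also have "\<dots> = 1"
    using cone_volume_sphere_pos[OF assms] cone_volume_sphere_finite[of n]
    by (intro ennreal_divide_self) auto
  finally show ?thesis .
qed

section \<open>Polar decomposition of an isotropic Gaussian vector\<close>

lemma (in prob_space) distr_isotropic_gaussian:
  assumes n: "0 < n" and X: "isotropic_gaussian M n v X" and v: "0 < v"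
  shows "distr M (lborel_coord n) (\<lambda>\<omega>. \<lambda>m\<in>{1..n}. X m \<omega>) =
    density (lborel_coord n) (\<lambda>a. ennreal ((1 / sqrt (2 * pi * v)) ^ n * exp (- (coord_norm n a)\<^sup>2 / (2 * v))))"
proof -
  let ?L = "lborel_coord n" and ?\<phi> = "normal_density 0 (sqrt v)"
  interpret L: product_sigma_finite "\<lambda>_::nat. lborel :: real measure"
    by standard
  interpret N: prob_space "density lborel ?\<phi>"
    using v by (intro prob_space_normal_density) simp
  interpret N: product_sigma_finite "\<lambda>_::nat. density lborel ?\<phi>"
    by standard
  have ind: "indep_vars (\<lambda>_. borel) X {1..n}"
    and dens: "\<And>m. m \<in> {1..n} \<Longrightarrow> distributed M lborel (X m) ?\<phi>"
    using X by (auto simp: isotropic_gaussian_def)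
  have rv: "random_variable borel (X m)" if "m \<in> {1..n}" for m
    using distributed_measurable[OF dens[OF that]] by simp
  have d: "distr M borel (X m) = density lborel ?\<phi>" if "m \<in> {1..n}" for m
    using distributed_distr_eq_density[OF dens[OF that]] by (simp cong: distr_cong)
  have prod: "(\<Prod>m\<in>{1..n}. ennreal (?\<phi> (a m))) =
      ennreal ((1 / sqrt (2 * pi * v)) ^ n * exp (- (coord_norm n a)\<^sup>2 / (2 * v)))" for a
  proof -
    have "(\<Prod>m\<in>{1..n}. ennreal (?\<phi> (a m))) = ennreal (\<Prod>m\<in>{1..n}. ?\<phi> (a m))"
      by (intro prod_ennreal) simp
    also have "(\<Prod>m\<in>{1..n}. ?\<phi> (a m)) =
        (\<Prod>m\<in>{1..n}. 1 / sqrt (2 * pi * v)) * (\<Prod>m\<in>{1..n}. exp (- (a m)\<^sup>2 / (2 * v)))"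
      unfolding prod.distrib[symmetric] using v by (intro prod.cong refl) (simp add: normal_density_def)
    also have "(\<Prod>m\<in>{1..n}. exp (- (a m)\<^sup>2 / (2 * v))) = exp (\<Sum>m\<in>{1..n}. - (a m)\<^sup>2 / (2 * v))"
      by (simp add: exp_sum)
    also have "(\<Sum>m\<in>{1..n}. - (a m)\<^sup>2 / (2 * v)) = - (coord_norm n a)\<^sup>2 / (2 * v)"
      by (simp add: coord_norm_def sum_nonneg sum_negf flip: sum_divide_distrib)
    finally show ?thesis by simp
  qed
  have "distr M ?L (\<lambda>\<omega>. \<lambda>m\<in>{1..n}. X m \<omega>) = distr M (Pi\<^sub>M {1..n} (\<lambda>_. borel)) (\<lambda>\<omega>. \<lambda>m\<in>{1..n}. X m \<omega>)"
    by (intro distr_cong refl sets_PiM_cong) auto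
  also have "\<dots> = Pi\<^sub>M {1..n} (\<lambda>m. distr M borel (X m))"
    using ind n rv by (subst (asm) indep_vars_iff_distr_eq_PiM') auto
  also have "\<dots> = Pi\<^sub>M {1..n} (\<lambda>_. density lborel ?\<phi>)"
    by (intro PiM_cong refl d)
  also have "\<dots> = density ?L (\<lambda>a. \<Prod>m\<in>{1..n}. ennreal (?\<phi> (a m)))"
  proof (rule N.PiM_eqI[symmetric])
    fix A :: "nat \<Rightarrow> real set"
    assume "\<And>i. i \<in> {1..n} \<Longrightarrow> A i \<in> sets (density lborel ?\<phi>)"
    then have A: "\<And>i. i \<in> {1..n} \<Longrightarrow> A i \<in> sets borel"
      by simp
    then have PA: "Pi\<^sub>E {1..n} A \<in> sets ?L"
      by (intro sets_PiM_I_finite) auto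
    have "emeasure (density ?L (\<lambda>a. \<Prod>m\<in>{1..n}. ennreal (?\<phi> (a m)))) (Pi\<^sub>E {1..n} A) =
        (\<integral>\<^sup>+a. (\<Prod>m\<in>{1..n}. ennreal (?\<phi> (a m))) * indicator (Pi\<^sub>E {1..n} A) a \<partial>?L)"
      by (intro emeasure_density PA) measurable
    also have "\<dots> = (\<integral>\<^sup>+a. (\<Prod>m\<in>{1..n}. ennreal (?\<phi> (a m)) * indicator (A m) (a m)) \<partial>?L)"
    proof (intro nn_integral_cong)
      fix a assume "a \<in> space ?L"
      then have "indicator (Pi\<^sub>E {1..n} A) a = (\<Prod>m\<in>{1..n}. indicator (A m) (a m) :: ennreal)"
        by (auto simp: indicator_def space_PiM PiE_iff)
      then show "(\<Prod>m\<in>{1..n}. ennreal (?\<phi> (a m))) * indicator (Pi\<^sub>E {1..n} A) a =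
          (\<Prod>m\<in>{1..n}. ennreal (?\<phi> (a m)) * indicator (A m) (a m))"
        by (simp add: prod.distrib)
    qed
    also have "\<dots> = (\<Prod>m\<in>{1..n}. \<integral>\<^sup>+x. ennreal (?\<phi> x) * indicator (A m) x \<partial>lborel)"
      using A by (intro L.product_nn_integral_prod) auto
    also have "\<dots> = (\<Prod>m\<in>{1..n}. emeasure (density lborel ?\<phi>) (A m))"
      using A by (intro prod.cong refl) (simp add: emeasure_density)
    finally show "emeasure (density ?L (\<lambda>a. \<Prod>m\<in>{1..n}. ennreal (?\<phi> (a m)))) (Pi\<^sub>E {1..n} A) =
        (\<Prod>m\<in>{1..n}. emeasure (density lborel ?\<phi>) (A m))" .
  qed (auto intro!: sets_PiM_cong)
  finally show ?thesis
    by (simp only: prod)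
qed

text \<open>The coefficient vector of the field of one fixed degree: covariance \<open>I/n\<close>, so that its norm
  concentrates at \<open>1\<close>.\<close>

locale normalized_gaussian = prob_space M
  for M :: "'w measure" +
  fixes n :: nat and X :: "nat \<Rightarrow> 'w \<Rightarrow> real"
  assumes n: "0 < n" and gaussian: "isotropic_gaussian M n (1 / real n) X"
begin

definition coeffs :: "'w \<Rightarrow> nat \<Rightarrow> real" where
  "coeffs \<omega> = (\<lambda>m\<in>{1..n}. X m \<omega>)"

definition radius :: "'w \<Rightarrow> real" where
  "radius \<omega> = coord_norm n (coeffs \<omega>)"

text \<open>The Gaussian density as a function of the distance to the origin.\<close>

definition gaussian_profile :: "real \<Rightarrow> real" where
  "gaussian_profile s = (1 / sqrt (2 * pi / real n)) ^ n * exp (- (real n * s\<^sup>2 / 2))"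

lemma gaussian_profile_nonneg: "0 \<le> gaussian_profile s"
  by (simp add: gaussian_profile_def)

lemma gaussian_profile_measurable [measurable]: "gaussian_profile \<in> borel_measurable borel"
  unfolding gaussian_profile_def by measurable

lemma X_measurable:
  assumes "m \<in> {1..n}"
  shows "X m \<in> borel_measurable M"
proof -
  have "distributed M lborel (X m) (normal_density 0 (sqrt (1 / real n)))"
    using gaussian assms by (simp add: isotropic_gaussian_def)
  from distributed_measurable[OF this] show ?thesis by simp
qed

lemma coeffs_measurable [measurable]: "coeffs \<in> measurable M (lborel_coord n)"
  unfolding coeffs_def using X_measurable by (intro measurable_restrict) auto

lemma radius_measurable [measurable]: "radius \<in> borel_measurable M"
  unfolding radius_def by measurable

lemma distr_coeffs: "distr M (lborel_coord n) coeffs = density (lborel_coord n) (\<lambda>a. ennreal (gaussian_profile (coord_norm n a)))"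
  using distr_isotropic_gaussian[OF n gaussian] n
  by (simp add: coeffs_def[abs_def] gaussian_profile_def mult.commute)

text \<open>The factor by which the event \<open>radius \<in> B\<close> enters the Gaussian measure of a cone.\<close>

definition radial_mass :: "real set \<Rightarrow> ennreal" where
  "radial_mass B = (\<integral>\<^sup>+s. ennreal (gaussian_profile s) * indicator B s *
     (ennreal (real n * s ^ (n - 1)) * indicator {0<..} s) \<partial>lborel)"

lemma emeasure_dir_radius:
  assumes A: "A \<in> sets (lborel_coord n)" "A \<subseteq> coord_sphere n" and B: "B \<in> sets borel"
  shows "emeasure M {\<omega> \<in> space M. coeffs \<omega> \<in> cone n A \<and> radius \<omega> \<in> B} = cone_volume n A * radial_mass B"
proof -
  let ?L = "lborel_coord n"
  let ?C = "{a \<in> cone n A. coord_norm n a \<in> B}"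
  note [measurable] = B
  have C: "?C \<in> sets ?L"
  proof -
    have "?C = cone n A \<inter> (coord_norm n -` B \<inter> space ?L)"
      by (auto simp: cone_def)
    also have "\<dots> \<in> sets ?L"
      using measurable_sets[OF coord_norm_measurable B] cone_measurable[OF A(1)] by (rule sets.Int[rotated])
    finally show ?thesis .
  qed
  have "emeasure M {\<omega> \<in> space M. coeffs \<omega> \<in> cone n A \<and> radius \<omega> \<in> B} = emeasure M (coeffs -` ?C \<inter> space M)"
    by (intro arg_cong[where f = "emeasure M"]) (auto simp: radius_def)
  also have "\<dots> = emeasure (distr M ?L coeffs) ?C"
    using C by (simp add: emeasure_distr)
  also have "\<dots> = (\<integral>\<^sup>+a. ennreal (gaussian_profile (coord_norm n a)) * indicator ?C a \<partial>?L)"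
    unfolding distr_coeffs by (intro emeasure_density C) measurable
  also have "\<dots> = (\<integral>\<^sup>+a. (ennreal (gaussian_profile (coord_norm n a)) * indicator B (coord_norm n a)) * indicator (cone n A) a \<partial>?L)"
    by (intro nn_integral_cong) (auto simp: indicator_def)
  also have "\<dots> = cone_volume n A * radial_mass B"
    unfolding radial_mass_def
    by (intro nn_integral_cone[OF n A, where h = "\<lambda>s. ennreal (gaussian_profile s) * indicator B s"]) measurable
  finally show ?thesis .
qed

lemma AE_radius_pos: "AE \<omega> in M. 0 < radius \<omega>"
proof -
  have "AE a in lborel_coord n. coord_norm n a \<noteq> 0"
    by (rule AE_I'[OF emeasure_coord_norm_zero[OF n]]) auto
  then have "AE a in distr M (lborel_coord n) coeffs. 0 < coord_norm n a"
    unfolding distr_coeffs by (subst AE_density) (auto simp: less_le)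
  then show ?thesis
    unfolding radius_def by (subst (asm) AE_distr_iff) auto
qed

lemma emeasure_radius:
  assumes B: "B \<in> sets borel"
  shows "emeasure M {\<omega> \<in> space M. radius \<omega> \<in> B} = cone_volume n (coord_sphere n) * radial_mass B"
proof -
  have "emeasure M {\<omega> \<in> space M. radius \<omega> \<in> B} =
      emeasure M {\<omega> \<in> space M. coeffs \<omega> \<in> cone n (coord_sphere n) \<and> radius \<omega> \<in> B}"
  proof (rule emeasure_eq_AE)
    show "AE \<omega> in M. \<omega> \<in> {\<omega> \<in> space M. radius \<omega> \<in> B} \<longleftrightarrow>
        \<omega> \<in> {\<omega> \<in> space M. coeffs \<omega> \<in> cone n (coord_sphere n) \<and> radius \<omega> \<in> B}"
      using AE_radius_pos
      by eventually_elim (use measurable_space[OF coeffs_measurable] in \<open>auto simp: cone_sphere radius_def\<close>)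
    have "{\<omega> \<in> space M. radius \<omega> \<in> B} = radius -` B \<inter> space M"
      by auto
    then show "{\<omega> \<in> space M. radius \<omega> \<in> B} \<in> sets M"
      using B by simp
    have "{\<omega> \<in> space M. coeffs \<omega> \<in> cone n (coord_sphere n) \<and> radius \<omega> \<in> B} =
        (coeffs -` cone n (coord_sphere n) \<inter> space M) \<inter> (radius -` B \<inter> space M)"
      by auto
    also have "\<dots> \<in> sets M"
      using B by (intro sets.Int measurable_sets[OF coeffs_measurable] measurable_sets[OF radius_measurable]
          cone_measurable coord_sphere_measurable)
    finally show "{\<omega> \<in> space M. coeffs \<omega> \<in> cone n (coord_sphere n) \<and> radius \<omega> \<in> B} \<in> sets M" .
  qed
  also have "\<dots> = cone_volume n (coord_sphere n) * radial_mass B"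
    by (intro emeasure_dir_radius B order_refl coord_sphere_measurable)
  finally show ?thesis .
qed

text \<open>Independence of direction and radius: \<open>emeasure_dir_radius\<close> exhibits a product, whose first
  factor is, up to normalization, the uniform measure of the set of directions.\<close>

lemma dir_radius_independent:
  assumes A: "A \<in> sets (restrict_space (lborel_coord n) (coord_sphere n))" and B: "B \<in> sets borel"
  shows "emeasure M {\<omega> \<in> space M. coeffs \<omega> \<in> cone n A \<and> radius \<omega> \<in> B} =
    emeasure (coord_sphere_measure n) A * emeasure M {\<omega> \<in> space M. radius \<omega> \<in> B}"
proof -
  have "cone_volume n (coord_sphere n) / cone_volume n (coord_sphere n) = 1"
    using cone_volume_sphere_pos[OF n] cone_volume_sphere_finite[of n]
    by (intro ennreal_divide_self) auto
  then have "cone_volume n A / cone_volume n (coord_sphere n) * (cone_volume n (coord_sphere n) * radial_mass B)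
      = cone_volume n A * radial_mass B"
    by (metis ennreal_times_divide mult.assoc mult.commute mult.right_neutral)
  then show ?thesis
    by (simp only: emeasure_coord_sphere_measure[OF A] emeasure_radius[OF B]
        emeasure_dir_radius[OF sets_restrict_coord_sphereD[OF A] B])
qed

text \<open>For a median \<open>r = exp (- L)\<close> of the radius, \<open>sqrt ((n - 1) / n) \<le> r \<le> 1\<close> amounts to
  \<open>0 \<le> L \<le> ln (n / (n - 1)) / 2\<close>, which is at most \<open>1 / n\<close>. The estimate is of order \<open>1 / n\<close>,
  not of the order \<open>1 / sqrt n\<close> of the fluctuations of the radius; the summand \<open>1 / n\<close> of the
  final bound comes from here.\<close>

lemma radius_median:
  assumes "2 \<le> n"
  obtains L where "0 \<le> L" "L \<le> 1 / real n"
    "1 / 2 \<le> emeasure M {\<omega> \<in> space M. radius \<omega> \<in> {..exp (- L)}}"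
    "1 / 2 \<le> emeasure M {\<omega> \<in> space M. radius \<omega> \<in> {exp (- L)..}}"
proof -
  define v where "v = enn2real (cone_volume n (coord_sphere n))"
  have v: "cone_volume n (coord_sphere n) = ennreal v"
    using cone_volume_sphere_finite[of n] by (simp add: v_def)
  have "0 \<le> v" by (simp add: v_def)
  define k where "k = v * (1 / sqrt (2 * pi / real n)) ^ n * real n"
  have k: "0 \<le> k" using \<open>0 \<le> v\<close> by (simp add: k_def)
  define f where "f s = k * s ^ (n - 1) * exp (- (real n * s\<^sup>2 / 2))" for s
  define F where "F r = measure M {\<omega> \<in> space M. radius \<omega> \<le> r}" for r
  \<comment> \<open>Starting the integral at \<open>- 1\<close> gives \<open>H\<close> a two-sided derivative at \<open>0\<close>.\<close>
  define H where "H r = integral {- 1..r} f" for r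
  have cf: "continuous_on S f" for S
    unfolding f_def by (intro continuous_intros) auto
  have [measurable]: "f \<in> borel_measurable borel"
    unfolding f_def by measurable
  have H: "(H has_real_derivative f x) (at x)" if "- 1 < x" for x
  proof -
    have "((\<lambda>x. integral {- 1..x} f) has_real_derivative f x) (at x within {- 1..x + 1})"
      using that by (intro integral_has_real_derivative cf) auto
    moreover have "at x within {- 1..x + 1} = at x"
      using that by (intro at_within_interior) auto
    ultimately show ?thesis by (simp add: H_def[abs_def])
  qed
  have FH: "F r = H r - H 0" if "0 \<le> r" for r
  proof -
    have HH: "(\<integral>\<^sup>+x. ennreal (f x) * indicator {0..r} x \<partial>lborel) = ennreal (H r - H 0)"
      using that k by (intro nn_integral_FTC_Icc H) (auto simp: f_def)
    have "emeasure M {\<omega> \<in> space M. radius \<omega> \<in> {..r}} = ennreal v * radial_mass {..r}"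
      by (simp only: emeasure_radius[OF borel_closed[OF closed_atMost]] v)
    also have "\<dots> = (\<integral>\<^sup>+s. ennreal v * (ennreal (gaussian_profile s) * indicator {..r} s *
       (ennreal (real n * s ^ (n - 1)) * indicator {0<..} s)) \<partial>lborel)"
      unfolding radial_mass_def by (intro nn_integral_cmult[symmetric]) measurable
    also have "\<dots> = (\<integral>\<^sup>+x. ennreal (f x) * indicator {0..r} x \<partial>lborel)"
    proof (intro nn_integral_cong_AE AE_I[of _ _ "{0}"])
      have "ennreal v * (ennreal (gaussian_profile s) * ennreal (real n * s ^ (n - 1))) = ennreal (f s)" if "0 < s" for s
        using that \<open>0 \<le> v\<close> gaussian_profile_nonneg[of s]
        by (simp add: f_def k_def gaussian_profile_def mult_ac flip: ennreal_mult)
      then show "{s \<in> space lborel. \<not> (ennreal v * (ennreal (gaussian_profile s) * indicator {..r} s *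
          (ennreal (real n * s ^ (n - 1)) * indicator {0<..} s)) = ennreal (f s) * indicator {0..r} s)} \<subseteq> {0}"
        by (auto simp: indicator_def)
    qed auto
    finally have "emeasure M {\<omega> \<in> space M. radius \<omega> \<le> r} = ennreal (H r - H 0)"
      unfolding HH by simp
    moreover have "0 \<le> H r - H 0"
      using DERIV_nonneg_imp_nondecreasing[OF that, of H] H k by (force simp: f_def)
    ultimately show ?thesis
      by (simp add: F_def measure_def)
  qed
  interpret normalized_chi_cdf n k f F
  proof
    show "(F has_real_derivative f s) (at s)" if "0 < s" for s
    proof (rule has_field_derivative_transform_within_open)
      show "((\<lambda>r. H r - H 0) has_real_derivative f s) (at s)"
        using that by (auto intro!: derivative_eq_intros H)
      show "open {0::real<..}" "s \<in> {0<..}" "\<And>r. r \<in> {0<..} \<Longrightarrow> H r - H 0 = F r"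
        using that by (auto simp: FH)
    qed
    have "continuous_on {0..} (\<lambda>r. H r - H 0)"
      by (intro continuous_intros continuous_at_imp_continuous_on ballI) (auto intro!: DERIV_isCont H)
    then show "continuous_on {0..} F"
      by (rule continuous_on_eq) (auto simp: FH)
    show "F 0 = 0" by (simp add: FH)
    show "(F \<longlongrightarrow> 1) at_top"
    proof -
      interpret D: real_distribution "distr M borel radius"
        by (rule real_distribution_distr) measurable
      have "F = cdf (distr M borel radius)"
        by (auto simp: F_def cdf_def measure_distr vimage_def fun_eq_iff Int_def conj_commute)
      then show ?thesis
        using D.cdf_lim_at_top_prob by simp
    qed
  qed (use assms k in \<open>auto simp: f_def F_def\<close>)
  obtain r where r: "sqrt ((real n - 1) / real n) \<le> r" "r \<le> 1" "F r = 1 / 2"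
    by (rule median_exists)
  define q where "q = (real n - 1) / real n"
  have q: "0 < q" using assms by (simp add: q_def)
  with r have rpos: "0 < r" by (metis q_def less_le_trans real_sqrt_gt_zero)
  show thesis
  proof
    show "0 \<le> - ln r" using r rpos by simp
    have "- ln r \<le> - ln (sqrt q)"
      using r rpos q by (simp add: q_def del: ln_sqrt)
    also have "\<dots> = ln (1 / q) / 2"
      using q by (simp add: ln_sqrt ln_div)
    also have "\<dots> \<le> (1 / q - 1) / 2"
      using q by (intro divide_right_mono ln_le_minus_one) auto
    also have "\<dots> \<le> 1 / real n"
      using assms by (simp add: q_def divide_simps)
    finally show "- ln r \<le> 1 / real n" .
    have e: "emeasure M {\<omega> \<in> space M. radius \<omega> \<le> r} = ennreal (1 / 2)"
      unfolding emeasure_eq_measure r(3)[unfolded F_def] ..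
    have er: "exp (- (- ln r)) = r"
      using rpos by simp
    have half: "ennreal (1 / 2) = 1 / 2"
      by (simp add: divide_ennreal_def)
    show "1 / 2 \<le> emeasure M {\<omega> \<in> space M. radius \<omega> \<in> {..exp (- (- ln r))}}"
      unfolding er atMost_iff e half ..
    have "prob {\<omega> \<in> space M. \<not> radius \<omega> \<le> r} = 1 - F r"
      unfolding F_def by (intro prob_neg) measurable
    also have "\<dots> = 1 / 2" by (simp add: r)
    finally have "1 / 2 = prob {\<omega> \<in> space M. \<not> radius \<omega> \<le> r}" ..
    also have "\<dots> \<le> prob {\<omega> \<in> space M. r \<le> radius \<omega>}"
      by (intro finite_measure_mono) auto
    finally have "ennreal (1 / 2) \<le> emeasure M {\<omega> \<in> space M. r \<le> radius \<omega>}"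
      unfolding emeasure_eq_measure by (rule ennreal_leI)
    then show "1 / 2 \<le> emeasure M {\<omega> \<in> space M. radius \<omega> \<in> {exp (- (- ln r))..}}"
      unfolding er atLeast_iff half .
  qed
qed

end

section \<open>Log-Lipschitz means and Chebyshev's inequality\<close>

text \<open>Along the curve \<open>t \<mapsto> exp (- t) u\<close> the speed equals the distance to the origin, which the
  factor \<open>1 + \<bar>u\<bar>\<close> in the derivative bound compensates.\<close>

lemma derivative_bound_imp_log_Lipschitz:
  fixes \<psi> :: "real \<Rightarrow> real"
  assumes diff: "\<And>u. \<psi> differentiable at u"
    and bound: "\<And>u. \<bar>deriv \<psi> u\<bar> \<le> c / (1 + \<bar>u\<bar>)"
    and "L \<ge> 0"
  shows "\<bar>\<psi> (exp (- L) * u) - \<psi> u\<bar> \<le> c * L"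
proof -
  have c: "c \<ge> 0" using bound[of 0] by simp
  have D: "((\<lambda>t. \<psi> (exp (- t) * u)) has_real_derivative
      deriv \<psi> (exp (- t) * u) * (- exp (- t) * u)) (at t)" for t
    by (rule DERIV_chain2[where f = \<psi>])
       (auto intro!: derivative_eq_intros DERIV_deriv_iff_real_differentiable[THEN iffD2] diff)
  have B: "\<bar>deriv \<psi> (exp (- t) * u) * (- exp (- t) * u)\<bar> \<le> c" for t
  proof -
    have "\<bar>deriv \<psi> (exp (- t) * u) * (- exp (- t) * u)\<bar>
        = \<bar>deriv \<psi> (exp (- t) * u)\<bar> * \<bar>exp (- t) * u\<bar>"
      by (simp add: abs_mult)
    also have "\<dots> \<le> c / (1 + \<bar>exp (- t) * u\<bar>) * \<bar>exp (- t) * u\<bar>"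
      by (intro mult_right_mono bound) auto
    also have "\<dots> \<le> c"
      using c by (simp add: divide_simps add_pos_nonneg algebra_simps)
    finally show ?thesis .
  qed
  have "norm (\<psi> (exp (- L) * u) - \<psi> (exp (- 0) * u)) \<le> c * norm (L - 0)"
    by (rule field_differentiable_bound[where S = UNIV, OF _ _ _ _ _, where f = "\<lambda>t. \<psi> (exp (- t) * u)",
          OF convex_UNIV has_field_derivative_at_within[OF D]])
       (use B in auto)
  then show ?thesis using assms(3) by simp
qed

text \<open>Chebyshev's inequality will be applied with \<open>\<epsilon> - \<delta>\<close> in place of \<open>\<epsilon>\<close>, where \<open>\<delta> \<le> c / n\<close>. Under
  the hypothesis \<open>large\<close>, which says that the bound to be proved is below \<open>1\<close>, the number \<open>\<epsilon>\<close>
  dominates \<open>\<delta>\<close>, and the weighted inequality \<open>\<epsilon>\<^sup>2 \<le> (1 + c) ((\<epsilon> - \<delta>)\<^sup>2 + \<delta>\<^sup>2 / c)\<close> trades the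
  shift for the factor \<open>1 + c\<close> and the summand \<open>1 / n\<close>.\<close>

lemma chebyshev_bound_absorbs_shift:
  fixes n s c \<epsilon> \<delta> :: real
  assumes n: "n > 0" and c: "c > 0" and s: "s \<ge> 0" and \<epsilon>: "0 < \<epsilon>" "\<epsilon> < 1"
    and \<delta>: "0 \<le> \<delta>" "\<delta> \<le> c / n"
    and large: "2 * (1 + c) * (1 / n + s) < \<epsilon>\<^sup>2"
  shows "\<delta> < \<epsilon>" "2 * s / (\<epsilon> - \<delta>)\<^sup>2 \<le> 2 * (1 + c) * (1 / n + s) / \<epsilon>\<^sup>2"
proof -
  \<comment> \<open>In \<open>large\<close>, the summand \<open>1 / n\<close> alone yields \<open>\<delta> \<le> \<epsilon> / 2\<close>, and \<open>s\<close> alone \<open>s \<le> \<epsilon>\<^sup>2 / 2\<close>.\<close>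
  have "2 * (1 + c) * (1 / n) \<le> 2 * (1 + c) * (1 / n + s)"
    using c s by (intro mult_left_mono) auto
  with large have "2 * (1 + c) * (1 / n) < \<epsilon>\<^sup>2"
    by linarith
  then have n\<epsilon>: "2 * (1 + c) < n * \<epsilon>\<^sup>2"
    using n by (simp add: field_simps)
  have \<epsilon>2: "\<epsilon>\<^sup>2 \<le> \<epsilon>" "\<epsilon>\<^sup>2 \<le> 1"
    using \<epsilon> by (auto simp: power2_eq_square mult_le_one mult_left_le)
  have n\<epsilon>2: "n * \<epsilon>\<^sup>2 \<le> n * \<epsilon>" "n * \<epsilon>\<^sup>2 \<le> n * 1"
    using n \<epsilon>2 by (auto intro: mult_left_mono)
  with n\<epsilon> c have "2 * c < n * \<epsilon> \<and> 2 * c < n"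
    by argo
  then have "c / n \<le> \<epsilon> / 2" and cn: "c / n \<le> 1 / 2"
    using n by (simp_all add: field_simps)
  with \<delta> have \<delta>\<epsilon>: "\<delta> \<le> \<epsilon> / 2"
    by linarith
  with \<epsilon> show "\<delta> < \<epsilon>"
    by linarith
  have "2 * 1 * s \<le> 2 * (1 + c) * (1 / n + s)"
    using c s n by (intro mult_mono) auto
  with large have s\<epsilon>: "s \<le> \<epsilon>\<^sup>2 / 2"
    by linarith
  have "(\<epsilon> / 2)\<^sup>2 \<le> (\<epsilon> - \<delta>)\<^sup>2"
    using \<delta>\<epsilon> \<epsilon> by (intro power_mono) auto
  moreover have "s * (c / n) \<le> \<epsilon>\<^sup>2 / 2 * (1 / 2)"
    using s\<epsilon> cn s c n by (intro mult_mono) auto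
  moreover have "\<epsilon>\<^sup>2 / 2 * (1 / 2) = (\<epsilon> / 2)\<^sup>2"
    by (simp add: power2_eq_square)
  ultimately have small: "s * (c / n) \<le> (\<epsilon> - \<delta>)\<^sup>2"
    by linarith
  have "s * \<delta>\<^sup>2 \<le> s * (c / n)\<^sup>2"
    using \<delta> s by (intro mult_left_mono power_mono) auto
  also have "\<dots> = (s * (c / n)) * (c / n)"
    by (simp add: power2_eq_square)
  also have "\<dots> \<le> (\<epsilon> - \<delta>)\<^sup>2 * (c / n)"
    using small c n by (intro mult_right_mono) auto
  finally have rest: "s * \<delta>\<^sup>2 / c \<le> (\<epsilon> - \<delta>)\<^sup>2 / n"
    using c by (simp add: field_simps)
  have "0 \<le> (c * (\<epsilon> - \<delta>) - \<delta>)\<^sup>2 / c"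
    using c by simp
  also have "\<dots> = (1 + c) * ((\<epsilon> - \<delta>)\<^sup>2 + \<delta>\<^sup>2 / c) - \<epsilon>\<^sup>2"
    using c by (simp add: power2_eq_square field_simps)
  finally have "s * \<epsilon>\<^sup>2 \<le> s * ((1 + c) * ((\<epsilon> - \<delta>)\<^sup>2 + \<delta>\<^sup>2 / c))"
    using s by (intro mult_left_mono) auto
  also have "\<dots> = (1 + c) * (s * (\<epsilon> - \<delta>)\<^sup>2 + s * \<delta>\<^sup>2 / c)"
    by (simp add: algebra_simps)
  also have "\<dots> \<le> (1 + c) * (s * (\<epsilon> - \<delta>)\<^sup>2 + (\<epsilon> - \<delta>)\<^sup>2 / n)"
    using rest c by (intro mult_left_mono) auto
  also have "\<dots> = (1 + c) * (1 / n + s) * (\<epsilon> - \<delta>)\<^sup>2"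
    by (simp add: algebra_simps)
  finally have "2 * s * \<epsilon>\<^sup>2 \<le> 2 * (1 + c) * (1 / n + s) * (\<epsilon> - \<delta>)\<^sup>2"
    by (simp only: mult.assoc mult_le_cancel_left_pos zero_less_numeral)
  moreover have "0 < (\<epsilon> - \<delta>)\<^sup>2" "0 < \<epsilon>\<^sup>2"
    using \<epsilon> \<open>\<delta> < \<epsilon>\<close> by simp_all
  ultimately show "2 * s / (\<epsilon> - \<delta>)\<^sup>2 \<le> 2 * (1 + c) * (1 / n + s) / \<epsilon>\<^sup>2"
    by (simp only: pos_divide_le_eq pos_le_divide_eq times_divide_eq_left)
qed

lemma emeasure_deviation_le_ext_variance:
  assumes X: "X \<in> borel_measurable M" and e: "0 < e"
  shows "emeasure M {\<omega> \<in> space M. \<bar>X \<omega> - integral\<^sup>L M X\<bar> > e} \<le> ext_variance M X / ennreal (e\<^sup>2)"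
proof -
  note [measurable] = X
  let ?V = "\<lambda>\<omega>. ennreal ((X \<omega> - integral\<^sup>L M X)\<^sup>2)"
  have "emeasure M {\<omega> \<in> space M. \<bar>X \<omega> - integral\<^sup>L M X\<bar> > e} \<le>
      emeasure M {\<omega> \<in> space M. 1 \<le> ennreal (1 / e\<^sup>2) * ?V \<omega>}"
  proof (intro emeasure_mono subsetI)
    fix \<omega> assume *: "\<omega> \<in> {\<omega> \<in> space M. \<bar>X \<omega> - integral\<^sup>L M X\<bar> > e}"
    then have "e\<^sup>2 \<le> (X \<omega> - integral\<^sup>L M X)\<^sup>2"
      using e by (simp add: power2_le_iff_abs_le flip: abs_le_square_iff)
    then have "1 \<le> 1 / e\<^sup>2 * (X \<omega> - integral\<^sup>L M X)\<^sup>2"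
      using e by simp
    then show "\<omega> \<in> {\<omega> \<in> space M. 1 \<le> ennreal (1 / e\<^sup>2) * ?V \<omega>}"
      using * by (simp flip: ennreal_mult)
  qed measurable
  also have "\<dots> \<le> ennreal (1 / e\<^sup>2) * (\<integral>\<^sup>+\<omega>. ?V \<omega> * indicator (space M) \<omega> \<partial>M)"
    by (intro nn_integral_Markov_inequality) auto
  also have "(\<integral>\<^sup>+\<omega>. ?V \<omega> * indicator (space M) \<omega> \<partial>M) = ext_variance M X"
    unfolding ext_variance_def by (intro nn_integral_cong) auto
  also have "ennreal (1 / e\<^sup>2) * ext_variance M X = ext_variance M X / ennreal (e\<^sup>2)"
    using e by (simp add: divide_ennreal_def inverse_ennreal divide_inverse mult.commute)
  finally show ?thesis .
qed

section \<open>Deviations on the sphere\<close>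

text \<open>Write the Gaussian vector as \<open>t \<theta>\<close> with \<open>\<theta>\<close> on the sphere. By homogeneity \<open>\<Phi> w\<close> at this vector
  equals \<open>\<Phi> (w / t) \<theta>\<close>. If \<open>\<Phi> u \<theta>\<close> is too large, then so is \<open>\<Phi> (w / t) \<theta>\<close> whenever \<open>t \<in> B\<close>; the
  event \<open>t \<in> B\<close> is independent of \<open>\<theta>\<close> and has probability at least one half. So the upper tail
  on the sphere is at most twice the Gaussian upper tail. The set \<open>C\<close> does the same for the
  lower tails, and the two Gaussian tails are disjoint.\<close>

lemma (in normalized_gaussian) sphere_deviation_le_gaussian_deviation:
  fixes \<Phi> :: "real \<Rightarrow> (nat \<Rightarrow> real) \<Rightarrow> real"
  assumes homogeneous: "\<And>s u a. 0 < s \<Longrightarrow> \<Phi> (s * u) (\<lambda>m\<in>{1..n}. s * a m) = \<Phi> u a"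
    and meas: "\<Phi> u \<in> borel_measurable (coord_sphere_measure n)"
    and meas': "(\<lambda>\<omega>. \<Phi> w (coeffs \<omega>)) \<in> borel_measurable M"
    and B: "B \<in> sets borel" "1 / 2 \<le> emeasure M {\<omega> \<in> space M. radius \<omega> \<in> B}"
      "\<And>a s. s \<in> B \<Longrightarrow> 0 < s \<Longrightarrow> \<Phi> u a \<le> \<Phi> (w / s) a"
    and C: "C \<in> sets borel" "1 / 2 \<le> emeasure M {\<omega> \<in> space M. radius \<omega> \<in> C}"
      "\<And>a s. s \<in> C \<Longrightarrow> 0 < s \<Longrightarrow> \<Phi> (w / s) a \<le> \<Phi> u a"
    and "0 < e"
  shows "emeasure (coord_sphere_measure n) {a \<in> coord_sphere n. \<bar>\<Phi> u a - y\<bar> > e} \<le>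
    2 * emeasure M {\<omega> \<in> space M. \<bar>\<Phi> w (coeffs \<omega>) - y\<bar> > e}"
proof -
  let ?\<mu> = "coord_sphere_measure n"
  define N where "N = distr (uniform_measure (restrict_space (lborel_coord n) (coord_ball n)) (coord_ball n))
           (restrict_space (lborel_coord n) (coord_sphere n))
           (\<lambda>a. \<lambda>m\<in>{1..n}. a m / coord_norm n a)"
  have \<mu>: "?\<mu> = completion N"
    by (simp add: N_def coord_sphere_measure_def)
  have setsN: "sets N = sets (restrict_space (lborel_coord n) (coord_sphere n))"
    by (simp add: N_def)
  have space: "space ?\<mu> = coord_sphere n"
    by (simp add: \<mu> N_def space_restrict_space coord_sphere_def)
  note [measurable] = meas meas'
  have scaled: "\<Phi> w (coeffs \<omega>) = \<Phi> (w / radius \<omega>) (coord_dir n (coeffs \<omega>))" if "0 < radius \<omega>" for \<omega>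
  proof -
    have "(\<lambda>m\<in>{1..n}. radius \<omega> * coord_dir n (coeffs \<omega>) m) = coeffs \<omega>"
      using that by (auto simp: coord_dir_def radius_def coeffs_def fun_eq_iff)
    then show ?thesis
      using homogeneous[OF that, of "w / radius \<omega>" "coord_dir n (coeffs \<omega>)"] that by simp
  qed
  have half: "emeasure ?\<mu> S \<le> 2 * emeasure M E"
    if S: "S \<in> sets ?\<mu>" and E: "E \<in> sets M"
      and D: "D \<in> sets borel" "1 / 2 \<le> emeasure M {\<omega> \<in> space M. radius \<omega> \<in> D}"
      and sub: "\<And>\<omega>. \<omega> \<in> space M \<Longrightarrow> 0 < radius \<omega> \<Longrightarrow> radius \<omega> \<in> D \<Longrightarrow>
        coord_dir n (coeffs \<omega>) \<in> S \<Longrightarrow> \<omega> \<in> E" for S E D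
  proof -
    \<comment> \<open>\<open>S\<close> need not be Borel, but it has a Borel subset of the same measure, and a subset suffices for \<open>sub\<close>.\<close>
    define A where "A = main_part N S"
    have SN: "S \<in> sets (completion N)"
      using S by (simp add: \<mu>)
    have A: "A \<in> sets (restrict_space (lborel_coord n) (coord_sphere n))"
      using main_part_sets[OF SN] by (simp add: A_def setsN)
    have "A \<subseteq> S"
      using main_part_null_part_Un[OF SN] by (auto simp: A_def)
    have "A \<in> sets (completion N)"
      using main_part_sets[OF SN] by (auto simp: A_def)
    then have SA: "emeasure ?\<mu> S = emeasure ?\<mu> A"
      using SN main_part_sets[OF SN] by (simp add: \<mu> A_def)
    have "emeasure ?\<mu> A * (1 / 2) \<le> emeasure ?\<mu> A * emeasure M {\<omega> \<in> space M. radius \<omega> \<in> D}"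
      by (intro mult_left_mono D) simp
    also have "\<dots> = emeasure M {\<omega> \<in> space M. coeffs \<omega> \<in> cone n A \<and> radius \<omega> \<in> D}"
      by (rule dir_radius_independent[OF A D(1), symmetric])
    also have "\<dots> \<le> emeasure M E"
      using E \<open>A \<subseteq> S\<close> sub by (intro emeasure_mono) (auto simp: cone_def radius_def)
    finally have "2 * (emeasure ?\<mu> A * (1 / 2)) \<le> 2 * emeasure M E"
      by (rule mult_left_mono) simp
    moreover have "2 * (emeasure ?\<mu> A * (1 / 2)) = emeasure ?\<mu> A"
    proof -
      have "(2::ennreal) * (1 / 2) = 1"
        by (simp add: ennreal_times_divide)
      then show ?thesis
        by (metis mult.left_commute mult.right_neutral)
    qed
    ultimately show ?thesis
      by (simp add: SA)
  qed
  let ?Sp = "{a \<in> space ?\<mu>. \<Phi> u a > y + e}" and ?Sm = "{a \<in> space ?\<mu>. \<Phi> u a < y - e}"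
  let ?Ep = "{\<omega> \<in> space M. \<Phi> w (coeffs \<omega>) > y + e}" and ?Em = "{\<omega> \<in> space M. \<Phi> w (coeffs \<omega>) < y - e}"
  have sets: "?Sp \<in> sets ?\<mu>" "?Sm \<in> sets ?\<mu>" "?Ep \<in> sets M" "?Em \<in> sets M"
    by measurable
  have p: "emeasure ?\<mu> ?Sp \<le> 2 * emeasure M ?Ep"
  proof (rule half[OF sets(1,3) B(1,2)])
    fix \<omega> assume "\<omega> \<in> space M" "0 < radius \<omega>" "radius \<omega> \<in> B" "coord_dir n (coeffs \<omega>) \<in> ?Sp"
    then show "\<omega> \<in> ?Ep"
      using B(3)[of "radius \<omega>" "coord_dir n (coeffs \<omega>)"] by (simp add: scaled)
  qed
  have m: "emeasure ?\<mu> ?Sm \<le> 2 * emeasure M ?Em"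
  proof (rule half[OF sets(2,4) C(1,2)])
    fix \<omega> assume "\<omega> \<in> space M" "0 < radius \<omega>" "radius \<omega> \<in> C" "coord_dir n (coeffs \<omega>) \<in> ?Sm"
    then show "\<omega> \<in> ?Em"
      using C(3)[of "radius \<omega>" "coord_dir n (coeffs \<omega>)"] by (simp add: scaled)
  qed
  have "{a \<in> coord_sphere n. \<bar>\<Phi> u a - y\<bar> > e} = ?Sp \<union> ?Sm"
    by (auto simp: space)
  then have "emeasure ?\<mu> {a \<in> coord_sphere n. \<bar>\<Phi> u a - y\<bar> > e} \<le> emeasure ?\<mu> ?Sp + emeasure ?\<mu> ?Sm"
    using emeasure_subadditive[OF sets(1,2)] by simp
  also have "\<dots> \<le> 2 * (emeasure M ?Ep + emeasure M ?Em)"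
    using add_mono[OF p m] by (simp add: distrib_left)
  also have "emeasure M ?Ep + emeasure M ?Em = emeasure M (?Ep \<union> ?Em)"
    using sets(3,4) \<open>0 < e\<close> by (intro plus_emeasure) auto
  also have "?Ep \<union> ?Em = {\<omega> \<in> space M. \<bar>\<Phi> w (coeffs \<omega>) - y\<bar> > e}"
    by auto
  finally show ?thesis .
qed

text \<open>The comparison level is \<open>w = r u\<close> for the median radius \<open>r = exp (- L)\<close>: then \<open>w / t\<close> lies on
  one side of \<open>u\<close> for \<open>t \<le> r\<close> and on the other side for \<open>t \<ge> r\<close>, and both ranges of \<open>t\<close> have
  probability at least one half. Which range serves which tail depends on the sign of \<open>u\<close> and on
  the direction of monotonicity.\<close>

lemma (in normalized_gaussian) sphere_deviation_bound:
  fixes \<Phi> :: "real \<Rightarrow> (nat \<Rightarrow> real) \<Rightarrow> real" and V :: ennreal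
  defines "\<psi> \<equiv> \<lambda>u. (LINT \<omega>|M. \<Phi> u (coeffs \<omega>))"
  assumes homogeneous: "\<And>s u a. 0 < s \<Longrightarrow> \<Phi> (s * u) (\<lambda>m\<in>{1..n}. s * a m) = \<Phi> u a"
    and monotone: "(\<forall>a. mono (\<lambda>u. \<Phi> u a)) \<or> (\<forall>a. antimono (\<lambda>u. \<Phi> u a))"
    and meas: "\<Phi> u \<in> borel_measurable (coord_sphere_measure n)"
    and meas': "\<And>w. (\<lambda>\<omega>. \<Phi> w (coeffs \<omega>)) \<in> borel_measurable M"
    and var: "\<And>w. ext_variance M (\<lambda>\<omega>. \<Phi> w (coeffs \<omega>)) \<le> V"
    and diff: "\<And>w. \<psi> differentiable at w"
    and bound: "\<And>w. \<bar>deriv \<psi> w\<bar> \<le> c / (1 + \<bar>w\<bar>)"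
    and c: "0 < c" and \<epsilon>: "0 < \<epsilon>" "\<epsilon> < 1"
  shows "emeasure (coord_sphere_measure n) {a \<in> coord_sphere n. \<bar>\<Phi> u a - \<psi> u\<bar> > \<epsilon>} \<le>
    ennreal (2 * (1 + c) / \<epsilon>\<^sup>2) * (ennreal (1 / real n) + V)" (is "?P \<le> ?R")
proof (cases V)
  case top
  then show ?thesis
    using c \<epsilon> by (simp add: ennreal_mult_top)
next
  case (real s)
  have R: "?R = ennreal (2 * (1 + c) * (1 / real n + s) / \<epsilon>\<^sup>2)"
    using real c \<epsilon> by (simp add: ennreal_plus[symmetric] ennreal_mult[symmetric] del: ennreal_plus)
  show ?thesis
  proof (cases "2 * (1 + c) * (1 / real n + s) < \<epsilon>\<^sup>2")
    \<comment> \<open>The asserted bound is at least \<open>1\<close>.\<close>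
    case False
    then have "1 \<le> ?R"
      unfolding R using \<epsilon> by simp
    with emeasure_coord_sphere_measure_le_1[OF n] show ?thesis
      by (rule order_trans)
  next
    case True
    have "n \<noteq> 1"
    proof
      assume "n = 1"
      with True have "(2 + 2 * c) * (1 + s) < \<epsilon>\<^sup>2"
        by simp
      moreover have "(2 + 2 * c) * 1 \<le> (2 + 2 * c) * (1 + s)"
        using c real by (intro mult_left_mono) auto
      ultimately have "2 + 2 * c < \<epsilon>\<^sup>2"
        by (metis le_less_trans mult.right_neutral)
      moreover have "\<epsilon>\<^sup>2 \<le> 1"
        using \<epsilon> by (simp add: power_le_one)
      ultimately show False
        using c by linarith
    qed
    with n have "2 \<le> n" by simp
    then obtain L where L: "0 \<le> L" "L \<le> 1 / real n"
      and med: "1 / 2 \<le> emeasure M {\<omega> \<in> space M. radius \<omega> \<in> {..exp (- L)}}"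
        "1 / 2 \<le> emeasure M {\<omega> \<in> space M. radius \<omega> \<in> {exp (- L)..}}"
      by (rule radius_median)
    define w where "w = exp (- L) * u"
    define \<delta> where "\<delta> = c * L"
    have \<delta>: "0 \<le> \<delta>" "\<delta> \<le> c / real n"
      using L c mult_left_mono[of L "1 / real n" c] by (auto simp: \<delta>_def)
    have \<delta>\<epsilon>: "\<delta> < \<epsilon>" and const: "2 * s / (\<epsilon> - \<delta>)\<^sup>2 \<le> 2 * (1 + c) * (1 / real n + s) / \<epsilon>\<^sup>2"
      using chebyshev_bound_absorbs_shift[OF _ c _ \<epsilon> \<delta> True] n real by auto
    have lip: "\<bar>\<psi> w - \<psi> u\<bar> \<le> \<delta>"
      unfolding w_def \<delta>_def by (rule derivative_bound_imp_log_Lipschitz[OF diff bound L(1)])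
    have "\<exists>B C. B \<in> sets borel \<and> C \<in> sets borel \<and>
        1 / 2 \<le> emeasure M {\<omega> \<in> space M. radius \<omega> \<in> B} \<and> 1 / 2 \<le> emeasure M {\<omega> \<in> space M. radius \<omega> \<in> C} \<and>
        (\<forall>t\<in>B. 0 < t \<longrightarrow> u \<le> w / t) \<and> (\<forall>t\<in>C. 0 < t \<longrightarrow> w / t \<le> u)"
    proof (cases "0 \<le> u")
      case True
      have "u \<le> w / t" if "0 < t" "t \<le> exp (- L)" for t
        using mult_right_mono[OF that(2) True] that(1) by (simp add: w_def pos_le_divide_eq mult.commute)
      moreover have "w / t \<le> u" if "0 < t" "exp (- L) \<le> t" for t
        using mult_right_mono[OF that(2) True] that(1) by (simp add: w_def pos_divide_le_eq mult.commute)
      ultimately show ?thesis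
        using med by (intro exI[of _ "{..exp (- L)}"] exI[of _ "{exp (- L)..}"]) simp
    next
      case False
      have "w / t \<le> u" if "0 < t" "t \<le> exp (- L)" for t
        using mult_right_mono_neg[OF that(2), of u] False that(1)
        by (simp add: w_def pos_divide_le_eq mult.commute)
      moreover have "u \<le> w / t" if "0 < t" "exp (- L) \<le> t" for t
        using mult_right_mono_neg[OF that(2), of u] False that(1)
        by (simp add: w_def pos_le_divide_eq mult.commute)
      ultimately show ?thesis
        using med by (intro exI[of _ "{exp (- L)..}"] exI[of _ "{..exp (- L)}"]) simp
    qed
    then obtain B C where BC: "B \<in> sets borel" "C \<in> sets borel"
        "1 / 2 \<le> emeasure M {\<omega> \<in> space M. radius \<omega> \<in> B}" "1 / 2 \<le> emeasure M {\<omega> \<in> space M. radius \<omega> \<in> C}"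
      and B: "\<And>t. t \<in> B \<Longrightarrow> 0 < t \<Longrightarrow> u \<le> w / t" and C: "\<And>t. t \<in> C \<Longrightarrow> 0 < t \<Longrightarrow> w / t \<le> u"
      by blast
    have "?P \<le> 2 * emeasure M {\<omega> \<in> space M. \<bar>\<Phi> w (coeffs \<omega>) - \<psi> u\<bar> > \<epsilon>}"
      using monotone
    proof
      assume "\<forall>a. mono (\<lambda>u. \<Phi> u a)"
      then show ?thesis
        by (intro sphere_deviation_le_gaussian_deviation[OF homogeneous meas meas' BC(1,3) _ BC(2,4)])
           (auto dest: monoD B C simp: \<epsilon>)
    next
      assume "\<forall>a. antimono (\<lambda>u. \<Phi> u a)"
      then show ?thesis
        by (intro sphere_deviation_le_gaussian_deviation[OF homogeneous meas meas' BC(2,4) _ BC(1,3)])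
           (auto dest: antimonoD B C simp: \<epsilon>)
    qed
    also have "\<dots> \<le> 2 * emeasure M {\<omega> \<in> space M. \<bar>\<Phi> w (coeffs \<omega>) - \<psi> w\<bar> > \<epsilon> - \<delta>}"
    proof (intro mult_left_mono emeasure_mono)
      show "{\<omega> \<in> space M. \<bar>\<Phi> w (coeffs \<omega>) - \<psi> w\<bar> > \<epsilon> - \<delta>} \<in> sets M"
        using meas'[of w] by measurable
    qed (use lip in auto)
    also have "\<dots> \<le> 2 * (V / ennreal ((\<epsilon> - \<delta>)\<^sup>2))"
    proof (intro mult_left_mono)
      have "emeasure M {\<omega> \<in> space M. \<bar>\<Phi> w (coeffs \<omega>) - \<psi> w\<bar> > \<epsilon> - \<delta>}
          \<le> ext_variance M (\<lambda>\<omega>. \<Phi> w (coeffs \<omega>)) / ennreal ((\<epsilon> - \<delta>)\<^sup>2)"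
        unfolding \<psi>_def using \<delta>\<epsilon> by (intro emeasure_deviation_le_ext_variance meas') simp
      also have "\<dots> \<le> V / ennreal ((\<epsilon> - \<delta>)\<^sup>2)"
        by (intro divide_right_mono_ennreal var)
      finally show "emeasure M {\<omega> \<in> space M. \<bar>\<Phi> w (coeffs \<omega>) - \<psi> w\<bar> > \<epsilon> - \<delta>}
          \<le> V / ennreal ((\<epsilon> - \<delta>)\<^sup>2)" .
    qed simp
    also have "\<dots> = ennreal (2 * s / (\<epsilon> - \<delta>)\<^sup>2)"
    proof -
      have "V / ennreal ((\<epsilon> - \<delta>)\<^sup>2) = ennreal (s / (\<epsilon> - \<delta>)\<^sup>2)"
        using real \<delta>\<epsilon> by (simp add: divide_ennreal)
      moreover have "2 * ennreal (s / (\<epsilon> - \<delta>)\<^sup>2) = ennreal (2 * (s / (\<epsilon> - \<delta>)\<^sup>2))"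
        by (subst ennreal_mult') (use real in auto)
      ultimately show ?thesis by simp
    qed
    also have "\<dots> \<le> ?R"
      unfolding R using const by (rule ennreal_leI)
    finally show ?thesis .
  qed
qed

section \<open>Excursion functionals of random spherical harmonics\<close>

lemma excursion_set_measurable:
  assumes "continuous_on (sphere 0 1) f"
  shows "excursion_set u f \<in> sets (restrict_space borel (sphere 0 1))"
proof -
  have "closedin (top_of_set (sphere 0 1)) (sphere 0 1 \<inter> f -` {u..})"
    using continuous_closedin_preimage[OF assms, of "{u..}"] by simp
  then have "closed (sphere 0 1 \<inter> f -` {u..})"
    using closedin_closed_trans closed_sphere by blast
  moreover have "excursion_set u f = sphere 0 1 \<inter> f -` {u..}"
    by (auto simp: excursion_set_def)
  ultimately show ?thesis
    by (auto simp: sets_restrict_space_iff)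
qed

lemma eigenspace_continuous_on_sphere:
  assumes "f \<in> eigenspace d l"
  shows "continuous_on (sphere 0 1) f"
proof -
  have "Ck_on 0 (- {0}) (radial_ext f)"
    using assms unfolding eigenspace_def smooth_on_sphere_def by blast
  then have "continuous_on (sphere 0 1) (radial_ext f)"
    by (auto intro: continuous_on_subset)
  then show ?thesis
    by (rule continuous_on_eq) (simp add: radial_ext_def)
qed

lemma harm_sum_continuous_on_sphere:
  assumes "orthonormal_eigenbasis d l Y"
  shows "continuous_on (sphere 0 1) (harm_sum (harm_dim d l) Y a)"
proof -
  have "continuous_on (sphere 0 1) (Y m)" if "m \<in> {1..harm_dim d l}" for m
    using assms that eigenspace_continuous_on_sphere unfolding orthonormal_eigenbasis_def by blast
  then show ?thesis
    unfolding harm_sum_def by (intro continuous_intros)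
qed

lemma monotonic_functional_excursion:
  assumes g: "monotonic_functional g" and Y: "orthonormal_eigenbasis d l Y"
  shows "(\<forall>a. mono (\<lambda>u. g (excursion_set u (harm_sum (harm_dim d l) Y a)))) \<or>
    (\<forall>a. antimono (\<lambda>u. g (excursion_set u (harm_sum (harm_dim d l) Y a))))"
proof -
  let ?E = "\<lambda>u a. excursion_set u (harm_sum (harm_dim d l) Y a)"
  have sets: "?E u a \<in> sets (restrict_space borel (sphere 0 1))" for u a
    by (intro excursion_set_measurable harm_sum_continuous_on_sphere Y)
  have sub: "?E u a \<subseteq> ?E v a" if "v \<le> u" for u v a
    using that by (auto simp: excursion_set_def)
  show ?thesis
    using g unfolding monotonic_functional_def
  proof
    assume g: "mono_on (sets (restrict_space borel (sphere 0 1))) g"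
    then have "\<forall>a. antimono (\<lambda>u. g (?E u a))"
      by (intro allI antimonoI mono_onD[OF g] sets sub)
    then show ?thesis ..
  next
    assume g: "antimono_on (sets (restrict_space borel (sphere 0 1))) g"
    then have "\<forall>a. mono (\<lambda>u. g (?E u a))"
      by (intro allI monoI monotone_onD[OF g, simplified] sets sub)
    then show ?thesis ..
  qed
qed

text \<open>The homogeneity of the excursion sets that ties the Gaussian field to its restriction to
  coefficients of norm one.\<close>

lemma excursion_set_scale:
  assumes "0 < s"
  shows "excursion_set (s * u) (harm_sum n Y (\<lambda>m\<in>{1..n}. s * a m)) = excursion_set u (harm_sum n Y a)"
proof -
  have "harm_sum n Y (\<lambda>m\<in>{1..n}. s * a m) = (\<lambda>x. s * harm_sum n Y a x)"
    by (simp add: harm_sum_def fun_eq_iff sum_distrib_left mult.assoc)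
  then show ?thesis
    using assms by (simp add: excursion_set_def)
qed

lemma harm_dim_pos: "2 \<le> d \<Longrightarrow> 1 \<le> l \<Longrightarrow> 0 < harm_dim d l"
proof -
  assume "2 \<le> d" "1 \<le> l"
  then have "0 < real (harm_dim d l)"
    by (subst real_harm_dim) (auto intro!: mult_pos_pos divide_pos_pos zero_less_binomial)
  then show ?thesis by simp
qed

lemma emeasure_deviation_set_le:
  fixes Y :: "nat \<Rightarrow> 'a::euclidean_space \<Rightarrow> real"
  assumes "prob_space M" and d: "2 \<le> d" "1 \<le> l"
    and Y: "orthonormal_eigenbasis d l Y"
    and U: "isotropic_gaussian M n (1 / real n) U"
    and g: "monotonic_functional g"
    and T: "T = (\<lambda>\<omega>. harm_sum n Y (\<lambda>m. U m \<omega>))"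
    and dim: "n = harm_dim d l"
    and int: "\<And>u. integrable M (\<lambda>\<omega>. g (excursion_set u (T \<omega>)))"
    and diff: "\<And>u. mean_excursion M g T differentiable at u"
    and bound: "\<And>u. \<bar>deriv (mean_excursion M g T) u\<bar> \<le> c / (1 + \<bar>u\<bar>)"
    and meas: "\<And>u. (\<lambda>a. g (excursion_set u (harm_sum n Y a))) \<in> borel_measurable (coord_sphere_measure n)"
    and c: "0 < c" and \<epsilon>: "0 < \<epsilon>" "\<epsilon> < 1"
  shows "emeasure (coord_sphere_measure n) (deviation_set n Y g (mean_excursion M g T) \<epsilon> u) \<le>
    ennreal (2 * (1 + c) / \<epsilon>\<^sup>2) * (ennreal (1 / real n) + max_variance M g T)"
proof -
  interpret prob_space M by fact
  interpret normalized_gaussian M n U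
    by standard (use U d dim harm_dim_pos in auto)
  define \<Phi> where "\<Phi> u a = g (excursion_set u (harm_sum n Y a))" for u a
  have T': "g (excursion_set u (T \<omega>)) = \<Phi> u (coeffs \<omega>)" for u \<omega>
  proof -
    have "harm_sum n Y (coeffs \<omega>) = T \<omega>"
      by (simp add: T coeffs_def harm_sum_def fun_eq_iff)
    then show ?thesis by (simp add: \<Phi>_def)
  qed
  have mean: "mean_excursion M g T = (\<lambda>u. LINT \<omega>|M. \<Phi> u (coeffs \<omega>))"
    by (simp add: mean_excursion_def fun_eq_iff T')
  have "emeasure (coord_sphere_measure n)
      {a \<in> coord_sphere n. \<bar>\<Phi> u a - (LINT \<omega>|M. \<Phi> u (coeffs \<omega>))\<bar> > \<epsilon>} \<le>
    ennreal (2 * (1 + c) / \<epsilon>\<^sup>2) * (ennreal (1 / real n) + max_variance M g T)"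
  proof (rule sphere_deviation_bound)
    show "\<Phi> (s * u) (\<lambda>m\<in>{1..n}. s * a m) = \<Phi> u a" if "0 < s" for s u a
      by (simp add: \<Phi>_def excursion_set_scale[OF that])
    show "(\<forall>a. mono (\<lambda>u. \<Phi> u a)) \<or> (\<forall>a. antimono (\<lambda>u. \<Phi> u a))"
      unfolding \<Phi>_def dim by (rule monotonic_functional_excursion[OF g Y])
    show "\<Phi> u \<in> borel_measurable (coord_sphere_measure n)"
      using meas by (simp add: \<Phi>_def[abs_def])
    show "(\<lambda>\<omega>. \<Phi> w (coeffs \<omega>)) \<in> borel_measurable M" for w
      using int[of w] by (simp add: T')
    show "ext_variance M (\<lambda>\<omega>. \<Phi> w (coeffs \<omega>)) \<le> max_variance M g T" for w
      unfolding max_variance_def T' by (rule SUP_upper) simp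
    show "(\<lambda>u. LINT \<omega>|M. \<Phi> u (coeffs \<omega>)) differentiable at w" for w
      using diff[of w] by (simp add: mean)
    show "\<bar>deriv (\<lambda>u. LINT \<omega>|M. \<Phi> u (coeffs \<omega>)) w\<bar> \<le> c / (1 + \<bar>w\<bar>)" for w
      using bound[of w] by (simp add: mean)
  qed (fact c \<epsilon>)+
  then show ?thesis
    by (simp add: deviation_set_def mean \<Phi>_def)
qed

theorem theorem7:
  fixes d :: nat
    and Y :: "nat \<Rightarrow> nat \<Rightarrow> 'a::euclidean_space \<Rightarrow> real"
    and M :: "'w measure"
    and U :: "nat \<Rightarrow> nat \<Rightarrow> 'w \<Rightarrow> real"
    and T :: "nat \<Rightarrow> 'w \<Rightarrow> 'a \<Rightarrow> real"
    and g :: "nat \<Rightarrow> 'a set \<Rightarrow> real"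
    and c :: real
    and n :: "nat \<Rightarrow> nat"
    and \<Psi> :: "nat \<Rightarrow> real \<Rightarrow> real"
    and \<sigma>2 :: "nat \<Rightarrow> ennreal"
    and \<mu> :: "nat \<Rightarrow> (nat \<Rightarrow> real) measure"
    and G :: "nat \<Rightarrow> real \<Rightarrow> real \<Rightarrow> (nat \<Rightarrow> real) set"
  defines "n \<equiv> harm_dim d"
    and "T \<equiv> \<lambda>l \<omega>. harm_sum (n l) (Y l) (\<lambda>m. U l m \<omega>)"
    and "\<Psi> \<equiv> \<lambda>l. mean_excursion M (g l) (T l)"
    and "\<sigma>2 \<equiv> \<lambda>l. max_variance M (g l) (T l)"
    and "\<mu> \<equiv> \<lambda>l. coord_sphere_measure (n l)"
    and "G \<equiv> \<lambda>l. deviation_set (n l) (Y l) (g l) (\<Psi> l)"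
  assumes "d \<ge> 2" and "DIM('a) = d + 1"
    and basis: "\<And>l. l \<ge> 1 \<Longrightarrow> orthonormal_eigenbasis d l (Y l)"
    and "prob_space M"
    and gaussian: "\<And>l. l \<ge> 1 \<Longrightarrow> isotropic_gaussian M (n l) (1 / real (n l)) (U l)"
    and regular: "regular_family M g T"
    and meas: "\<And>l u. l \<ge> 1 \<Longrightarrow>
      (\<lambda>a. g l (excursion_set u (harm_sum (n l) (Y l) a))) \<in> borel_measurable (\<mu> l)"
    and "c > 0" and bound: "derivative_bound \<Psi> c"
  shows "(\<forall>\<epsilon> :: nat \<Rightarrow> real. (\<forall>l\<ge>1. 0 < \<epsilon> l \<and> \<epsilon> l < 1) \<longrightarrow>
            (\<forall>l\<ge>1. (SUP u. emeasure (\<mu> l) (G l (\<epsilon> l) u))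
                \<le> ennreal (2 * (1 + c) / (\<epsilon> l)\<^sup>2) * (ennreal (1 / real (n l)) + \<sigma>2 l))) \<and>
         (\<forall>\<epsilon> :: nat \<Rightarrow> real. (\<forall>l\<ge>1. 0 < \<epsilon> l \<and> \<epsilon> l < 1) \<longrightarrow> \<epsilon> \<longlonglongrightarrow> 0 \<longrightarrow>
            (\<lambda>l. (ennreal (1 / real (n l)) + \<sigma>2 l) / ennreal ((\<epsilon> l)\<^sup>2)) \<longlonglongrightarrow> 0 \<longrightarrow>
            (\<lambda>l. SUP u. emeasure (\<mu> l) (G l (\<epsilon> l) u)) \<longlonglongrightarrow> 0)"
proof (intro conjI allI impI)
  have single: "emeasure (coord_sphere_measure (n l))
        (deviation_set (n l) (Y l) (g l) (mean_excursion M (g l) (T l)) e u)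
      \<le> ennreal (2 * (1 + c) / e\<^sup>2) * (ennreal (1 / real (n l)) + max_variance M (g l) (T l))"
    if l: "1 \<le> l" and e: "0 < e" "e < 1" for l e u
  proof (rule emeasure_deviation_set_le[where d = d and l = l and U = "U l"])
    show "orthonormal_eigenbasis d l (Y l)" "isotropic_gaussian M (n l) (1 / real (n l)) (U l)"
      using l basis gaussian by auto
    show "monotonic_functional (g l)" "\<And>u. integrable M (\<lambda>\<omega>. g l (excursion_set u (T l \<omega>)))"
      "\<And>u. mean_excursion M (g l) (T l) differentiable at u"
      using regular l unfolding regular_family_def by blast+
    show "T l = (\<lambda>\<omega>. harm_sum (n l) (Y l) (\<lambda>m. U l m \<omega>))" "n l = harm_dim d l"
      by (simp_all add: T_def n_def)
    show "\<bar>deriv (mean_excursion M (g l) (T l)) u\<bar> \<le> c / (1 + \<bar>u\<bar>)" for u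
      using bound l by (simp add: derivative_bound_def \<Psi>_def)
    show "(\<lambda>a. g l (excursion_set u (harm_sum (n l) (Y l) a)))
        \<in> borel_measurable (coord_sphere_measure (n l))" for u
      using meas[OF l] by (simp add: \<mu>_def)
  qed (fact \<open>prob_space M\<close> \<open>d \<ge> 2\<close> \<open>c > 0\<close> l e)+
  have main: "(SUP u. emeasure (\<mu> l) (G l e u))
      \<le> ennreal (2 * (1 + c) / e\<^sup>2) * (ennreal (1 / real (n l)) + \<sigma>2 l)"
    if "1 \<le> l" "0 < e" "e < 1" for l e
    unfolding \<mu>_def G_def \<Psi>_def \<sigma>2_def by (intro SUP_least single that)
  show "(SUP u. emeasure (\<mu> l) (G l (\<epsilon> l) u))
      \<le> ennreal (2 * (1 + c) / (\<epsilon> l)\<^sup>2) * (ennreal (1 / real (n l)) + \<sigma>2 l)"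
    if "\<forall>l\<ge>1. 0 < \<epsilon> l \<and> \<epsilon> l < 1" "1 \<le> l" for \<epsilon> l
    using that by (intro main) auto
  fix \<epsilon> :: "nat \<Rightarrow> real"
  assume \<epsilon>: "\<forall>l\<ge>1. 0 < \<epsilon> l \<and> \<epsilon> l < 1"
    and lim: "(\<lambda>l. (ennreal (1 / real (n l)) + \<sigma>2 l) / ennreal ((\<epsilon> l)\<^sup>2)) \<longlonglongrightarrow> 0"
  have "(\<lambda>l. ennreal (2 * (1 + c)) * ((ennreal (1 / real (n l)) + \<sigma>2 l) / ennreal ((\<epsilon> l)\<^sup>2)))
      \<longlonglongrightarrow> ennreal (2 * (1 + c)) * 0"
    by (intro ennreal_tendsto_cmult lim) simp
  then have lim': "(\<lambda>l. ennreal (2 * (1 + c)) * ((ennreal (1 / real (n l)) + \<sigma>2 l) / ennreal ((\<epsilon> l)\<^sup>2)))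
      \<longlonglongrightarrow> 0"
    by simp
  show "(\<lambda>l. SUP u. emeasure (\<mu> l) (G l (\<epsilon> l) u)) \<longlonglongrightarrow> 0"
  proof (rule tendsto_sandwich[OF _ _ tendsto_const lim'])
    show "\<forall>\<^sub>F l in sequentially. (SUP u. emeasure (\<mu> l) (G l (\<epsilon> l) u))
        \<le> ennreal (2 * (1 + c)) * ((ennreal (1 / real (n l)) + \<sigma>2 l) / ennreal ((\<epsilon> l)\<^sup>2))"
    proof (rule eventually_sequentiallyI)
      fix l :: nat assume l: "1 \<le> l"
      then have e: "0 < \<epsilon> l" "\<epsilon> l < 1" using \<epsilon> by auto
      have "ennreal (2 * (1 + c) / (\<epsilon> l)\<^sup>2) = ennreal (2 * (1 + c)) / ennreal ((\<epsilon> l)\<^sup>2)"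
        using e \<open>c > 0\<close> by (intro divide_ennreal[symmetric]) auto
      then show "(SUP u. emeasure (\<mu> l) (G l (\<epsilon> l) u))
          \<le> ennreal (2 * (1 + c)) * ((ennreal (1 / real (n l)) + \<sigma>2 l) / ennreal ((\<epsilon> l)\<^sup>2))"
        using main[OF l e] by (simp add: divide_ennreal_def mult_ac)
    qed
  qed simp
qed

end
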